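(* For any integer $t \ge 0$, each of the seven H-trees (i) $\mathrm{H}(1 + t;\ 6 + 2t,\ 5 + 2t;\ 2 + t,\ 1)$, (ii) $\mathrm{H}(2 + t;\ 7 + 2t,\ 6 + 2t;\ 5 + t,\ 1)$, (iii) $\mathrm{H}(1 + 2t;\ 6 + 4t,\ 5 + 4t;\ 1 + 2t,\ 2)$, (iv) $\mathrm{H}(2 + 2t;\ 8 + 4t,\ 7 + 4t;\ 3 + 2t,\ 1)$, (v) $\mathrm{H}(3 + 2t;\ 8 + 4t,\ 7 + 4t;\ 6 + 2t,\ 1)$, (vi) $\mathrm{H}(1 + t;\ 7 + 4t,\ 6 + 4t;\ 6 + 3t,\ 1)$, (vii) $\mathrm{H}(2;\ 7 + 4t,\ 6 + 4t;\ 5 + 4t,\ 1)$ is transmission irregular.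
   Context: For a simple connected graph $G$, the transmission of a vertex $u$ is $\mathrm{Tr}_G(u) = \sum_{v \in V(G)} d_G(u,v)$, where $d_G$ is the graph distance. $G$ is transmission irregular if all its vertices have mutually distinct transmissions. For positive integers $C, A_1, A_2, B_1, B_2$, the H-tree $\mathrm{H}(C; A_1, A_2; B_1, B_2)$ is the tree with exactly two vertices $u, v$ of degree greater than two, both of degree $3$, such that $d(u,v) = C$, the two pendent paths starting at $u$ have lengths (numbers of edges) $A_1, A_2$, and the two pendent paths starting at $v$ have lengths $B_1, B_2$. *)

theory Defs
  imports "Graph_Theory.Graph_Theory"
begin

text \<open>
  A finite simple graph is a \<^locale>\<open>pair_graph\<close>: a finite, symmetric, loop-free set of ordered
  pairs on a finite vertex set. An edge between \<open>x\<close> and \<open>y\<close> is the two arcs \<open>(x, y)\<close> and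
  \<open>(y, x)\<close>, so the degree of a vertex is its \<^const>\<open>out_degree\<close>.
\<close>

abbreviation degree :: "'a pair_pre_digraph \<Rightarrow> 'a \<Rightarrow> nat" where
  "degree G x \<equiv> out_degree (with_proj G) x"

text \<open>Only meaningful when \<open>u\<close> and \<open>v\<close> are joined by a walk.\<close>

definition graph_dist :: "'a pair_pre_digraph \<Rightarrow> 'a \<Rightarrow> 'a \<Rightarrow> nat" where
  "graph_dist G u v = (LEAST n. \<exists>p. pre_digraph.awalk (with_proj G) u p v \<and> length p = n)"

definition transmission :: "'a pair_pre_digraph \<Rightarrow> 'a \<Rightarrow> nat" where
  "transmission G u = (\<Sum>v\<in>pverts G. graph_dist G u v)"

definition transmission_irregular :: "'a pair_pre_digraph \<Rightarrow> bool" where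
  "transmission_irregular G \<longleftrightarrow>
     pair_graph G \<and> connected (with_proj G) \<and> inj_on (transmission G) (pverts G)"

text \<open>
  The predicates \<^const>\<open>forest\<close> and \<^const>\<open>tree\<close> of the library count the closed walk \<open>x, y, x\<close>
  along a single undirected edge as a cycle, so no symmetric digraph with an edge satisfies
  them. Cycles of an undirected simple graph have length at least 3.
\<close>

definition simple_tree :: "'a pair_pre_digraph \<Rightarrow> bool" where
  "simple_tree G \<longleftrightarrow> pair_graph G \<and> connected (with_proj G) \<and>
     \<not> (\<exists>p. pre_digraph.cycle (with_proj G) p \<and> 3 \<le> length p)"

text \<open>
  A pendent path starting at \<open>u\<close>, as its list of vertices: it leads from the branching vertex \<open>u\<close>
  through vertices of degree 2 to a leaf.
\<close>

definition pendent_path :: "'a pair_pre_digraph \<Rightarrow> 'a \<Rightarrow> 'a list \<Rightarrow> bool" where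
  "pendent_path G u p \<longleftrightarrow> vpath p (with_proj G) \<and> 2 \<le> length p \<and>
     hd p = u \<and> 2 < degree G u \<and>
     (\<forall>x\<in>set (butlast (tl p)). degree G x = 2) \<and> degree G (last p) = 1"

text \<open>
  \<open>is_H_tree G C A\<^sub>1 A\<^sub>2 B\<^sub>1 B\<^sub>2\<close>: the graph \<open>G\<close> is (a copy of) the H-tree
  \<open>H(C; A\<^sub>1, A\<^sub>2; B\<^sub>1, B\<^sub>2)\<close>. No such \<open>G\<close> exists if one of the parameters is \<open>0\<close>.
\<close>

definition is_H_tree ::
  "'a pair_pre_digraph \<Rightarrow> nat \<Rightarrow> nat \<Rightarrow> nat \<Rightarrow> nat \<Rightarrow> nat \<Rightarrow> bool" where
  "is_H_tree G C A\<^sub>1 A\<^sub>2 B\<^sub>1 B\<^sub>2 \<longleftrightarrow> simple_tree G \<and>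
     (\<exists>u v. u \<noteq> v \<and> {x \<in> pverts G. 2 < degree G x} = {u, v} \<and>
        degree G u = 3 \<and> degree G v = 3 \<and> graph_dist G u v = C \<and>
        (\<exists>p q. p \<noteq> q \<and> {r. pendent_path G u r} = {p, q} \<and>
           vwalk_length p = A\<^sub>1 \<and> vwalk_length q = A\<^sub>2) \<and>
        (\<exists>p q. p \<noteq> q \<and> {r. pendent_path G v r} = {p, q} \<and>
           vwalk_length p = B\<^sub>1 \<and> vwalk_length q = B\<^sub>2))"

text \<open>
  The rest of the theory shows that H-trees exist for all positive parameters, so that
  \<^const>\<open>is_H_tree\<close> is not vacuous. The witness has the vertices \<open>(0, 0), ..., (0, C)\<close> on the
  path from \<open>u\<close> to \<open>v\<close> and \<open>(b, 1), (b, 2), ...\<close> on the \<open>b\<close>-th pendent path, for \<open>b = 1, ..., 4\<close>.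
\<close>

lemma pair_out_degree: "degree G x = card {y. (x, y) \<in> parcs G}"
proof -
  have "out_arcs (with_proj G) x = (\<lambda>y. (x, y)) ` {y. (x, y) \<in> parcs G}"
    by (auto simp: out_arcs_def)
  then show ?thesis
    by (simp add: out_degree_def card_image inj_on_def)
qed

lemma vwalk_arcs_set: "set (vwalk_arcs p) = {(p ! i, p ! Suc i) | i. Suc i < length p}"
proof (induction p rule: vwalk_arcs.induct)
  case (3 x y xs)
  show ?case
  proof (intro set_eqI iffI)
    fix e assume "e \<in> set (vwalk_arcs (x # y # xs))"
    then consider "e = (x, y)" | "e \<in> {((y # xs) ! i, (y # xs) ! Suc i) | i. Suc i < length (y # xs)}"
      using 3 by auto
    then show "e \<in> {((x # y # xs) ! i, (x # y # xs) ! Suc i) | i. Suc i < length (x # y # xs)}"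
    proof cases
      case 1 then show ?thesis by (auto intro!: exI[of _ 0])
    next
      case 2 then obtain i where "e = ((y # xs) ! i, (y # xs) ! Suc i)" "Suc i < length (y # xs)" by auto
      then show ?thesis by (auto intro!: exI[of _ "Suc i"])
    qed
  next
    fix e assume "e \<in> {((x # y # xs) ! i, (x # y # xs) ! Suc i) | i. Suc i < length (x # y # xs)}"
    then obtain i where i: "e = ((x # y # xs) ! i, (x # y # xs) ! Suc i)" "Suc i < length (x # y # xs)" by auto
    then show "e \<in> set (vwalk_arcs (x # y # xs))"
      unfolding vwalk_arcs.simps using 3 by (cases i) auto
  qed
qed auto

lemma vpath_nth:
  "vpath p (with_proj G) \<longleftrightarrow> set p \<subseteq> pverts G \<and> p \<noteq> [] \<and> distinct p \<and>
     (\<forall>i. Suc i < length p \<longrightarrow> (p ! i, p ! Suc i) \<in> parcs G)"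
  by (auto simp: vpath_def vwalk_def vwalk_arcs_set)

lemma deg2_step:
  assumes "degree G x = 2" "(x, a) \<in> parcs G" "(x, b) \<in> parcs G" "(x, c) \<in> parcs G"
    "a \<noteq> b" "a \<noteq> c"
  shows "b = c"
proof (rule ccontr)
  assume "b \<noteq> c"
  have "finite {y. (x, y) \<in> parcs G}"
    using assms(1) unfolding pair_out_degree by (metis card.infinite zero_neq_numeral)
  then have "card {a, b, c} \<le> card {y. (x, y) \<in> parcs G}"
    using assms by (intro card_mono) auto
  then show False
    using assms \<open>b \<noteq> c\<close> unfolding pair_out_degree by auto
qed

lemma branch_prefix:
  assumes "sym (parcs G)"
    and p: "vpath p (with_proj G)" "2 \<le> length p" "\<forall>x\<in>set (butlast (tl p)). degree G x = 2"
    and q: "vpath q (with_proj G)" "2 \<le> length q" "\<forall>x\<in>set (butlast (tl q)). degree G x = 2"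
    and "p ! 0 = q ! 0" "p ! 1 = q ! 1"
  shows "i < length p \<Longrightarrow> i < length q \<Longrightarrow> p ! i = q ! i"
proof (induction i rule: less_induct)
  case (less i)
  consider "i = 0" | "i = 1" | j where "i = Suc (Suc j)" by (metis One_nat_def not0_implies_Suc)
  then show ?case
  proof cases
    case 3
    have e: "p ! j = q ! j" "p ! Suc j = q ! Suc j" using less 3 by auto
    have "p ! Suc j = butlast (tl p) ! j" using less 3 by (simp add: nth_butlast nth_tl)
    moreover have "butlast (tl p) ! j \<in> set (butlast (tl p))" using less 3 by (intro nth_mem) simp
    ultimately have d: "degree G (p ! Suc j) = 2" using p by simp
    have "(p ! j, p ! Suc j) \<in> parcs G" "(p ! Suc j, p ! i) \<in> parcs G" "p ! j \<noteq> p ! i"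
      using p(1) less.prems(1) 3 by (auto simp: vpath_nth nth_eq_iff_index_eq)
    moreover from this have "(p ! Suc j, p ! j) \<in> parcs G" using assms(1) by (meson symD)
    moreover have "(q ! Suc j, q ! i) \<in> parcs G" "q ! j \<noteq> q ! i"
      using q(1) less.prems(2) 3 by (auto simp: vpath_nth nth_eq_iff_index_eq)
    ultimately show ?thesis using deg2_step[OF d] e by metis
  qed (use assms in auto)
qed

lemma branch_unique:
  assumes "sym (parcs G)"
    and p: "vpath p (with_proj G)" "2 \<le> length p" "\<forall>x\<in>set (butlast (tl p)). degree G x = 2" "degree G (last p) \<noteq> 2"
    and q: "vpath q (with_proj G)" "2 \<le> length q" "\<forall>x\<in>set (butlast (tl q)). degree G x = 2" "degree G (last q) \<noteq> 2"
    and "p ! 0 = q ! 0" "p ! 1 = q ! 1"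
  shows "p = q"
proof -
  have *: "\<not> length r < length s" if
    r: "2 \<le> length r" "degree G (last r) \<noteq> 2" and
    s: "\<forall>x\<in>set (butlast (tl s)). degree G x = 2" and
    eq: "\<And>i. i < length r \<Longrightarrow> i < length s \<Longrightarrow> r ! i = s ! i" for r s
  proof
    assume l: "length r < length s"
    have "last r = r ! (length r - 1)" using r by (metis last_conv_nth list.size(3) not_numeral_le_zero)
    also have "\<dots> = s ! (length r - 1)" using eq l r by simp
    also have "\<dots> = butlast (tl s) ! (length r - 2)"
      using l r by (simp add: nth_butlast nth_tl numeral_2_eq_2 Suc_diff_Suc)
    also have "\<dots> \<in> set (butlast (tl s))" using l r by (intro nth_mem) simp
    finally show False using r s by simp
  qed
  note pre = branch_prefix[OF assms(1) p(1-3) q(1-3) assms(10,11)]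
  have "length p = length q"
    using *[OF p(2,4) q(3) pre] *[OF q(2,4) p(3)] pre by (metis linorder_neqE_nat)
  then show ?thesis using pre by (intro nth_equalityI) auto
qed

lemma pcas_nth: "pcas u p v \<Longrightarrow> p \<noteq> [] \<Longrightarrow>
   fst (p ! 0) = u \<and> snd (p ! (length p - 1)) = v \<and>
   (\<forall>i. Suc i < length p \<longrightarrow> snd (p ! i) = fst (p ! Suc i))"
proof (induction p arbitrary: u)
  case (Cons e p)
  show ?case
  proof (cases "p = []")
    case False
    with Cons have IH: "fst (p ! 0) = snd e" "snd (p ! (length p - 1)) = v"
      "\<forall>i. Suc i < length p \<longrightarrow> snd (p ! i) = fst (p ! Suc i)" by auto
    have "snd ((e # p) ! i) = fst ((e # p) ! Suc i)" if "Suc i < length (e # p)" for i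
      using IH that by (cases i) auto
    then show ?thesis using Cons False IH by (auto simp: nth_Cons')
  qed (use Cons in auto)
qed simp

lemma rooted_tree:
  fixes V :: "'a set" and par :: "'a \<Rightarrow> 'a" and dep :: "'a \<Rightarrow> nat"
  assumes "finite V" "rt \<in> V"
    and par: "\<And>x. x \<in> V - {rt} \<Longrightarrow> par x \<in> V \<and> dep x = Suc (dep (par x))"
    and G: "G = \<lparr>pverts = V, parcs = (\<lambda>x. (x, par x)) ` (V - {rt}) \<union> (\<lambda>x. (par x, x)) ` (V - {rt})\<rparr>"
  shows "simple_tree G"
proof -
  have sym: "sym (parcs G)" by (auto simp: G sym_def)
  have par': "\<forall>x\<in>V. x = rt \<or> par x \<in> V \<and> par x \<noteq> x \<and> x \<noteq> par x"
    using par by (metis DiffI n_not_Suc_n singletonD)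
  have "pair_graph G"
    using \<open>finite V\<close> sym par' by unfold_locales (auto simp: G symmetric_def)
  then interpret pair_graph G .
  have arc: "(y = par x \<and> dep x = Suc (dep y)) \<or> (x = par y \<and> dep y = Suc (dep x))"
    if "(x, y) \<in> parcs G" for x y
    using that par by (auto simp: G)
  have rt: "x \<rightarrow>\<^sup>*\<^bsub>with_proj G\<^esub> rt" if "x \<in> V" for x
    using that
  proof (induction "dep x" arbitrary: x rule: less_induct)
    case less
    show ?case
    proof (cases "x = rt")
      case False
      then have "par x \<rightarrow>\<^sup>*\<^bsub>with_proj G\<^esub> rt" using less par by simp
      moreover have "(x, par x) \<in> parcs G" using less False by (auto simp: G)
      ultimately show ?thesis by (metis adj_reachable_trans with_proj_simps(3))
    next
      case True
      have "rt \<in> pverts G" using assms(2) by (simp add: G)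
      then show ?thesis using True reachable_refl by simp
    qed
  qed
  have symG: "symmetric (with_proj G)" using sym by (simp add: symmetric_def)
  have "x \<rightarrow>\<^sup>*\<^bsub>with_proj G\<^esub> y" if "x \<in> V" "y \<in> V" for x y
    using rt[OF that(1)] rt[OF that(2)] symG by (meson reachable_trans symmetric_reachable)
  moreover have "mk_symmetric (with_proj G) = G"
    using sym by (auto simp: mk_symmetric_def G)
  ultimately have conn: "connected (with_proj G)"
    using assms(2) by (auto simp: connected_def strongly_connected_def G)
  have "\<not> 3 \<le> length p" if cyc: "pre_digraph.cycle (with_proj G) p" for p
  proof
    assume 3: "3 \<le> length p"
    let ?n = "length p"
    from cyc obtain u where u: "awalk u p u" "distinct (tl (pawalk_verts u p))"
      by (auto simp: pre_digraph.cycle_def awalk_verts_with_proj_eq)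
    then have pc: "pcas u p u" "set p \<subseteq> parcs G" by (auto simp: awalk_def)
    have "p \<noteq> []" using 3 by auto
    note n = pcas_nth[OF pc(1) \<open>p \<noteq> []\<close>]
    have "tl (pawalk_verts u p) = map snd p"
      using awalk_verts_conv'[of u p u] pc \<open>p \<noteq> []\<close> by simp
    then have inj: "snd (p ! i) \<noteq> snd (p ! j)" if "i < ?n" "j < ?n" "i \<noteq> j" for i j
      using u(2) that by (metis distinct_conv_nth length_map nth_map)
    define s where "s i = (if Suc i = ?n then 0 else Suc i)" for i
    have s: "s i < ?n" "fst (p ! s i) = snd (p ! i)" if "i < ?n" for i
    proof -
      show "s i < ?n" using that \<open>p \<noteq> []\<close> by (simp add: s_def)
      show "fst (p ! s i) = snd (p ! i)"
      proof (cases "Suc i = ?n")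
        case True
        then have "i = ?n - 1" by simp
        then have "snd (p ! i) = u" using n by blast
        moreover have "s i = 0" using True by (simp add: s_def)
        ultimately show ?thesis using n by simp
      next
        case False
        then have "Suc i < ?n" "s i = Suc i" using that by (auto simp: s_def)
        then show ?thesis using n by metis
      qed
    qed
    have arcs: "(fst (p ! i), snd (p ! i)) \<in> parcs G" if "i < ?n" for i
      using that pc by auto
    define M where "M = Max ((\<lambda>i. dep (snd (p ! i))) ` {..<?n})"
    have "M \<in> (\<lambda>i. dep (snd (p ! i))) ` {..<?n}"
      unfolding M_def using \<open>p \<noteq> []\<close> by (intro Max_in) auto
    then obtain k where k: "k < ?n" "dep (snd (p ! k)) = M" by auto
    have le: "dep (snd (p ! i)) \<le> M" if "i < ?n" for i
      unfolding M_def using that by (intro Max_ge) auto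
    obtain j where j: "j < ?n" "s j = k"
    proof (cases k)
      case 0 then show ?thesis using that[of "?n - 1"] \<open>p \<noteq> []\<close> by (auto simp: s_def)
    next
      case (Suc l) then show ?thesis using that[of l] k by (auto simp: s_def)
    qed
    have "snd (p ! j) = par (snd (p ! k))"
      using arc[OF arcs[OF k(1)]] s(2)[OF j(1)] j(2) le[OF j(1)] k(2) by auto
    moreover have "snd (p ! s k) = par (snd (p ! k))"
      using arc[OF arcs[OF s(1)[OF k(1)]]] s(2)[OF k(1)] le[OF s(1)[OF k(1)]] k(2) by auto
    moreover have "j \<noteq> s k" using j k 3 by (auto simp: s_def split: if_splits)
    ultimately show False using inj j(1) s(1)[OF k(1)] by metis
  qed
  with conn \<open>pair_graph G\<close> show ?thesis by (auto simp: simple_tree_def)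
qed

lemma pendent_set:
  assumes "sym (parcs G)" "degree G u = 3" "{y. (u, y) \<in> parcs G} = {a, b, c}"
    and p: "pendent_path G u p" "p ! 1 = a" and q: "pendent_path G u q" "q ! 1 = b"
    and s: "vpath s (with_proj G)" "2 \<le> length s" "s ! 0 = u" "s ! 1 = c"
      "\<forall>x\<in>set (butlast (tl s)). degree G x = 2" "degree G (last s) = 3"
  shows "{r. pendent_path G u r} = {p, q}"
proof -
  have "r = p \<or> r = q" if r: "pendent_path G u r" for r
  proof -
    have 0: "x ! 0 = u" if "pendent_path G u x" for x
      using that by (metis pendent_path_def hd_conv_nth list.size(3) not_numeral_le_zero)
    have "(r ! 0, r ! 1) \<in> parcs G" using r by (auto simp: pendent_path_def vpath_nth)
    then have "r ! 1 \<in> {a, b, c}" using assms(3) 0[OF r] by auto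
    then consider "r ! 1 = a" | "r ! 1 = b" | "r ! 1 = c" by auto
    then show ?thesis
    proof cases
      case 1
      have "r = p" using r p 1 0[OF r] 0[OF p(1)]
        by (intro branch_unique[OF assms(1)]) (auto simp: pendent_path_def)
      then show ?thesis ..
    next
      case 2
      have "r = q" using r q 2 0[OF r] 0[OF q(1)]
        by (intro branch_unique[OF assms(1)]) (auto simp: pendent_path_def)
      then show ?thesis ..
    next
      case 3
      have "r = s" using r s 3 0[OF r]
        by (intro branch_unique[OF assms(1)]) (auto simp: pendent_path_def)
      then show ?thesis using r s by (auto simp: pendent_path_def)
    qed
  qed
  then show ?thesis using p q by auto
qed

lemma is_H_tree_exists:
  assumes pos: "0 < C" "0 < A\<^sub>1" "0 < A\<^sub>2" "0 < B\<^sub>1" "0 < B\<^sub>2"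
  shows "\<exists>G :: (nat \<times> nat) pair_pre_digraph. is_H_tree G C A\<^sub>1 A\<^sub>2 B\<^sub>1 B\<^sub>2"
proof -
  define L where "L b = (if b = 0 then C else if b = 1 then A\<^sub>1 else if b = 2 then A\<^sub>2
     else if b = 3 then B\<^sub>1 else B\<^sub>2)" for b :: nat
  have Lpos: "0 < L b" for b using pos by (auto simp: L_def)
  have L0: "L 0 = C" by (simp add: L_def)
  define V where "V = {(b, i) | b i. b \<le> 4 \<and> i \<le> L b \<and> (b = 0 \<or> 0 < i)}"
  define par where "par x = (case x of (b, i) \<Rightarrow> if b = 0 then (0, i - 1)
     else if 1 < i then (b, i - 1) else if b \<le> 2 then (0, 0) else (0, C))" for x :: "nat \<times> nat"
  define dep where "dep x = (case x of (b, i) \<Rightarrow> if 3 \<le> b then C + i else i)" for x :: "nat \<times> nat"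
  define G where "G = \<lparr>pverts = V, parcs = (\<lambda>x. (x, par x)) ` (V - {(0, 0)}) \<union> (\<lambda>x. (par x, x)) ` (V - {(0, 0)})\<rparr>"
  have "finite V"
    by (rule finite_subset[of _ "Sigma {..4} (\<lambda>b. {..L b})"]) (auto simp: V_def)
  have rV: "(0, 0) \<in> V" by (simp add: V_def)
  have par: "par x \<in> V \<and> dep x = Suc (dep (par x))" if "x \<in> V - {(0, 0)}" for x
  proof -
    obtain b i where x: "x = (b, i)" by force
    have *: "b \<le> 4" "i \<le> L b" "0 < i" using that by (auto simp: x V_def)
    consider "b = 0" | "0 < b" "1 < i" | "0 < b" "i = 1" using * by linarith
    then show ?thesis using * by cases (auto simp: x V_def par_def dep_def L0)
  qed
  have tree: "simple_tree G" by (rule rooted_tree[OF \<open>finite V\<close> rV par G_def])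
  then interpret pair_graph G by (simp add: simple_tree_def)
  have sym: "sym (parcs G)" by (auto simp: G_def sym_def)
  have pvG: "pverts G = V" by (simp add: G_def)
  have E: "(x, y) \<in> parcs G \<longleftrightarrow> (x \<in> V - {(0, 0)} \<and> y = par x) \<or> (y \<in> V - {(0, 0)} \<and> x = par y)" for x y
    by (auto simp: G_def)
  have N_u: "{y. ((0, 0), y) \<in> parcs G} = {(1, 1), (2, 1), (0, 1)}"
    using pos by (auto simp: E V_def par_def L_def split: if_splits)
  have N_v: "{y. ((0, C), y) \<in> parcs G} = {(3, 1), (4, 1), (0, C - 1)}"
    using pos by (auto simp: E V_def par_def L_def split: if_splits)
  have N_s: "{y. ((0, i), y) \<in> parcs G} = {(0, i - 1), (0, Suc i)}" if "0 < i" "i < C" for i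
    using that by (auto simp: E V_def par_def L0 split: if_splits)
  have N_b: "{y. ((b, i), y) \<in> parcs G} = (if i < L b then {par (b, i), (b, Suc i)} else {par (b, i)})"
    if "0 < b" "b \<le> 4" "0 < i" "i \<le> L b" for b i
    using that by (auto simp: E V_def par_def split: if_splits)
  have D_u: "degree G (0, 0) = 3" by (simp add: pair_out_degree N_u)
  have D_v: "degree G (0, C) = 3" by (simp add: pair_out_degree N_v)
  have D_s: "degree G (0, i) = 2" if "0 < i" "i < C" for i
    by (simp add: pair_out_degree N_s[OF that])
  have D_b: "degree G (b, i) = (if i < L b then 2 else 1)"
    if "0 < b" "b \<le> 4" "0 < i" "i \<le> L b" for b i
    using that by (auto simp: pair_out_degree N_b par_def)
  have big: "{x \<in> pverts G. 2 < degree G x} = {(0, 0), (0, C)}"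
  proof (intro set_eqI iffI)
    fix x assume x: "x \<in> {x \<in> pverts G. 2 < degree G x}"
    obtain b i where bi: "x = (b, i)" by force
    have V: "(b, i) \<in> V" and d: "2 < degree G (b, i)" using x by (auto simp: bi pvG)
    have "b = 0"
    proof (rule ccontr)
      assume "b \<noteq> 0"
      then have "degree G (b, i) \<le> 2" using V D_b[of b i] by (auto simp: V_def)
      then show False using d by simp
    qed
    moreover have "i = 0 \<or> i = C" using V d D_s[of i] \<open>b = 0\<close>
      by (cases "0 < i \<and> i < C") (auto simp: V_def L0)
    ultimately show "x \<in> {(0, 0), (0, C)}" using bi by auto
  qed (auto simp: D_u D_v pvG V_def L0)
  define P where "P b r = r # map (Pair b) [1..<Suc (L b)]" for b and r :: "nat \<times> nat"
  have P: "pendent_path G r (P b r) \<and> P b r ! 1 = (b, 1) \<and> vwalk_length (P b r) = L b"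
    if b: "0 < b" "b \<le> 4" "r = (if b \<le> 2 then (0, 0) else (0, C))" for b r
  proof -
    have nth: "P b r ! i = (b, i)" if "0 < i" "i \<le> L b" for i
      using that by (auto simp: P_def nth_Cons' nth_append)
    have len: "length (P b r) = Suc (L b)" by (simp add: P_def)
    have "last (P b r) = (b, L b)" using nth[of "L b"] Lpos[of b] len
      by (metis diff_Suc_1 last_conv_nth le_refl list.size(3) nat.distinct(1))
    moreover have "(P b r ! i, P b r ! Suc i) \<in> parcs G" if "Suc i < length (P b r)" for i
    proof (cases "i = 0")
      case True
      then show ?thesis using b nth[of 1] Lpos[of b] by (auto simp: E V_def par_def P_def)
    next
      case False
      then show ?thesis using b nth[of i] nth[of "Suc i"] that len by (auto simp: E V_def par_def)
    qed
    moreover have "set (P b r) \<subseteq> V" using b by (auto simp: P_def V_def L0)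
    moreover have "distinct (P b r)" using b by (auto simp: P_def distinct_map inj_on_def)
    moreover have "degree G x = 2" if x: "x \<in> set (butlast (tl (P b r)))" for x
    proof -
      have "x \<in> {(b, i) | i. 0 < i \<and> i < L b}"
        using x by (auto simp: P_def simp flip: map_butlast split: if_splits)
      then show ?thesis using b D_b by auto
    qed
    moreover have "2 < degree G r" using b D_u D_v by auto
    moreover have "degree G (b, L b) = 1" using D_b[of b "L b"] b Lpos[of b] by simp
    moreover have "hd (P b r) = r" "P b r \<noteq> []" by (simp_all add: P_def)
    moreover have "2 \<le> length (P b r)" "P b r ! 1 = (b, 1)" using len Lpos[of b] nth[of 1] by simp_all
    ultimately show ?thesis
      unfolding pendent_path_def vpath_nth pvG using len by simp
  qed
  define S where "S = map (Pair (0::nat)) [0..<Suc C]"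
  have nthS: "S ! i = (0, i)" if "i \<le> C" for i using that unfolding S_def by (simp del: upt_Suc)
  have lenS: "length S = Suc C" by (simp add: S_def)
  have arcS: "((0, i), (0, Suc i)) \<in> parcs G" "((0, Suc i), (0, i)) \<in> parcs G" if "i < C" for i
    using that by (auto simp: E V_def par_def L0)
  have S: "vpath S (with_proj G)"
    using nthS arcS lenS by (auto simp: vpath_nth distinct_map inj_on_def S_def pvG V_def L0 simp del: upt_Suc)
  have S': "vpath (rev S) (with_proj G)"
  proof -
    have "(rev S ! i, rev S ! Suc i) \<in> parcs G" if "Suc i < length (rev S)" for i
    proof -
      have "rev S ! i = (0, Suc (C - Suc i))" "rev S ! Suc i = (0, C - Suc i)"
        using that nthS lenS by (auto simp: rev_nth Suc_diff_Suc)
      then show ?thesis using arcS(2)[of "C - Suc i"] pos(1) by simp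
    qed
    then show ?thesis using S by (auto simp: vpath_nth)
  qed
  have mid: "set (butlast (tl S)) \<subseteq> {(0, i) | i. 0 < i \<and> i < C}"
    by (auto simp: S_def upt_rec[of 0] simp flip: map_butlast simp del: upt_Suc)
       (auto split: if_splits)
  have mid': "set (butlast (tl (rev S))) = set (butlast (tl S))"
    by (metis butlast_rev butlast_tl rev_rev_ident set_rev)
  have inner: "\<forall>x\<in>set (butlast (tl S)). degree G x = 2" using mid D_s by auto
  have ends: "last S = (0, C)" "last (rev S) = (0, 0)" "rev S ! 0 = (0, C)" "rev S ! 1 = (0, C - 1)"
    using nthS lenS pos(1) by (auto simp: last_conv_nth rev_nth last_rev hd_conv_nth S_def simp del: upt_Suc)
  have pu: "{r. pendent_path G (0, 0) r} = {P 1 (0, 0), P 2 (0, 0)}"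
    using P[of 1 "(0, 0)"] P[of 2 "(0, 0)"] S lenS nthS[of 0] nthS[of 1] inner ends D_v pos
    by (intro pendent_set[OF sym D_u N_u, of _ _ S]) auto
  have pv: "{r. pendent_path G (0, C) r} = {P 3 (0, C), P 4 (0, C)}"
    using P[of 3 "(0, C)"] P[of 4 "(0, C)"] S' lenS inner ends D_u pos mid'
    by (intro pendent_set[OF sym D_v N_v, of _ _ "rev S"]) auto
  have dep_le: "dep y \<le> dep x + length p" if "pcas x p y" "set p \<subseteq> parcs G" for x p y
    using that
  proof (induction p arbitrary: x)
    case (Cons e p)
    have "dep (snd e) \<le> Suc (dep (fst e))"
    proof -
      have "(fst e, snd e) \<in> parcs G" using Cons.prems by (cases e) auto
      then consider "fst e \<in> V - {(0, 0)}" "snd e = par (fst e)"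
        | "snd e \<in> V - {(0, 0)}" "fst e = par (snd e)"
        unfolding E by blast
      then show ?thesis using par[of "fst e"] par[of "snd e"] by cases simp_all
    qed
    then show ?case using Cons.IH[of "snd e"] Cons.prems by auto
  qed auto
  have walk: "\<exists>p. awalk (0, 0) p (0, k) \<and> length p = k" if "k \<le> C" for k
    using that
  proof (induction k)
    case 0 then show ?case using rV by (intro exI[of _ "[]"]) (auto simp: awalk_Nil_iff pvG)
  next
    case (Suc k)
    then obtain p where "awalk (0, 0) p (0, k)" "length p = k" by auto
    then show ?case using arcS[of k] Suc.prems
      by (intro exI[of _ "p @ [((0, k), (0, Suc k))]"])
         (auto simp: awalk_append_iff awalk_Cons_iff awalk_Nil_iff pvG V_def L0)
  qed
  have "graph_dist G (0, 0) (0, C) = C"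
    unfolding graph_dist_def
  proof (rule Least_equality)
    fix n assume "\<exists>p. awalk (0, 0) p (0, C) \<and> length p = n"
    then show "C \<le> n" using dep_le[of "(0, 0)" _ "(0, C)"] by (auto simp: awalk_def dep_def)
  qed (use walk[of C] in auto)
  moreover have "P 1 (0, 0) \<noteq> P 2 (0, 0)" "P 3 (0, C) \<noteq> P 4 (0, C)"
    using P[of 1 "(0, 0)"] P[of 2 "(0, 0)"] P[of 3 "(0, C)"] P[of 4 "(0, C)"] by auto
  moreover have "vwalk_length (P 1 (0, 0)) = A\<^sub>1" "vwalk_length (P 2 (0, 0)) = A\<^sub>2"
    "vwalk_length (P 3 (0, C)) = B\<^sub>1" "vwalk_length (P 4 (0, C)) = B\<^sub>2"
    using P[of 1 "(0, 0)"] P[of 2 "(0, 0)"] P[of 3 "(0, C)"] P[of 4 "(0, C)"] by (auto simp: L_def)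
  ultimately have
    "\<exists>p q. p \<noteq> q \<and> {r. pendent_path G (0, 0) r} = {p, q} \<and> vwalk_length p = A\<^sub>1 \<and> vwalk_length q = A\<^sub>2"
    "\<exists>p q. p \<noteq> q \<and> {r. pendent_path G (0, C) r} = {p, q} \<and> vwalk_length p = B\<^sub>1 \<and> vwalk_length q = B\<^sub>2"
    "graph_dist G (0, 0) (0, C) = C"
    using pu pv by blast+
  note facts = this
  have "is_H_tree G C A\<^sub>1 A\<^sub>2 B\<^sub>1 B\<^sub>2"
    unfolding is_H_tree_def
    by (rule conjI[OF tree], rule exI[of _ "(0, 0)"], rule exI[of _ "(0, C)"])
       (use pos(1) in \<open>intro conjI big D_u D_v facts; simp\<close>)
  then show ?thesis ..
qed

end

theory Submission
  imports Defs
begin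

text \<open>
  If an edge \<open>xy\<close> is a bridge and \<open>x\<close> lies on a side with \<open>k\<close> of the \<open>n\<close> vertices, then passing
  from \<open>x\<close> to \<open>y\<close> adds 1 to the distance from \<open>k\<close> vertices and subtracts 1 for the other \<open>n - k\<close>,
  so the transmission changes by \<open>2k - n\<close> (lemma \<open>transmission_across_bridge\<close>). Along a path
  of degree-2 vertices \<open>k\<close> grows by 1 at each step; hence on each of the five paths of an
  H-tree the transmission is a monic quadratic polynomial of the position \<open>i\<close>: its value at
  the hub \<open>u\<close> or \<open>v\<close> where the path starts, plus \<open>arm m i = i * (i + m)\<close> with a slope \<open>m\<close> that
  depends on the path. Relative to \<open>u\<close>, this expresses all transmissions by the parameters
  (\<open>map_transmission_vertex_list\<close>).

  That the five paths are disjoint up to the two hubs, and that they cover the graph, follows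
  from the degrees: a path through degree-2 vertices is determined by any of its steps
  (\<open>segments_sharing_inner_vertex\<close>), and a union of paths that is closed under
  adjacency is the whole connected graph.

  It remains to see that the listed numbers are distinct. In all seven families the two pendent
  paths at \<open>u\<close> have lengths \<open>A + 1\<close> and \<open>A\<close>, so their slopes are \<open>m\<close> and \<open>m + 2\<close>, and their values
  interlace:
  \<open>arm m 1 < arm (m + 2) 1 < arm m 2 < arm (m + 2) 2 < \<dots>\<close>.
  Every transmission on the other three paths, except that of \<open>u\<close>, turns out to lie strictly
  inside one of the gaps of this chain, and those on the second pendent path at \<open>v\<close> lie
  strictly between consecutive members of the sequence that the first one follows. With the index of
  the gap chosen as a suitable linear function of the position and \<open>t\<close>, the quadratic terms cancel in these
  comparisons, and linear inequalities remain.
\<close>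

section \<open>Transmissions across a bridge\<close>

locale connected_pair_graph = pair_graph +
  assumes connected: "connected (with_proj G)"
begin

lemma parcs_sym: "(x, y) \<in> parcs G \<Longrightarrow> (y, x) \<in> parcs G"
  using arcs_symmetric by blast

lemma sym_parcs: "sym (parcs G)"
  by (rule symI) (rule parcs_sym)

lemma graph_dist_le: "awalk x p y \<Longrightarrow> graph_dist G x y \<le> length p"
  unfolding graph_dist_def by (rule Least_le) blast

lemma shortest_awalk:
  assumes "x \<in> pverts G" "y \<in> pverts G"
  obtains p where "awalk x p y" "length p = graph_dist G x y"
proof -
  have "strongly_connected (with_proj G)"
    using connected symmetric_connected_imp_strongly_connected pair_sym_arcs by blast
  then have "x \<rightarrow>\<^sup>*\<^bsub>with_proj G\<^esub> y"
    using assms by (simp add: strongly_connected_def)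
  then obtain q where "awalk x q y"
    using reachable_awalk by blast
  then have "\<exists>n p. awalk x p y \<and> length p = n"
    by blast
  then have "\<exists>p. awalk x p y \<and> length p = graph_dist G x y"
    unfolding graph_dist_def by (rule LeastI_ex)
  then show thesis
    using that by blast
qed

lemma pverts_subset_if_arc_closed:
  assumes "x \<in> W" "x \<in> pverts G" and closed: "\<And>a b. (a, b) \<in> parcs G \<Longrightarrow> a \<in> W \<Longrightarrow> b \<in> W"
  shows "pverts G \<subseteq> W"
proof
  fix y assume "y \<in> pverts G"
  with assms obtain p where "awalk x p y"
    by (metis shortest_awalk)
  then show "y \<in> W"
    using \<open>x \<in> W\<close>
  proof (induction p arbitrary: x)
    case (Cons e p)
    then show ?case
      using closed[of "fst e" "snd e"] by (auto simp: awalk_Cons_iff)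
  qed (simp add: awalk_Nil_iff)
qed

text \<open>
  A walk from outside into \<open>X\<close> can enter \<open>X\<close> only at \<open>x\<close>; the rest of it is a strictly shorter
  walk from \<open>x\<close>.
\<close>

lemma awalk_through_bridge:
  assumes "awalk a p w" "a \<notin> X" "w \<in> X"
    and bridge: "\<And>a b. (a, b) \<in> parcs G \<Longrightarrow> a \<notin> X \<Longrightarrow> b \<in> X \<Longrightarrow> b = x"
  obtains q where "awalk x q w" "length q < length p"
proof -
  have "\<exists>q. awalk x q w \<and> length q < length p"
    using assms(1-2)
  proof (induction p arbitrary: a)
    case Nil
    then show ?case
      using \<open>w \<in> X\<close> by (simp add: awalk_Nil_iff)
  next
    case (Cons e p)
    then have e: "e \<in> parcs G" "fst e = a" "awalk (snd e) p w"
      by (auto simp: awalk_Cons_iff)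
    show ?case
    proof (cases "snd e \<in> X")
      case True
      then have "snd e = x"
        using bridge[of a "snd e"] e Cons.prems(2) by force
      then show ?thesis
        using e(3) by auto
    next
      case False
      then show ?thesis
        using Cons.IH[OF e(3)] less_Suc_eq by auto
    qed
  qed
  then show thesis
    using that by blast
qed

lemma graph_dist_across_bridge:
  assumes "(y, x) \<in> parcs G" "y \<notin> X" "w \<in> X" "w \<in> pverts G"
    and bridge: "\<And>a b. (a, b) \<in> parcs G \<Longrightarrow> a \<notin> X \<Longrightarrow> b \<in> X \<Longrightarrow> b = x"
  shows "graph_dist G y w = Suc (graph_dist G x w)"
proof (rule antisym)
  have "x \<in> pverts G" "y \<in> pverts G"
    using assms(1) by (auto dest: wellformed')
  obtain p where p: "awalk x p w" "length p = graph_dist G x w"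
    using shortest_awalk[OF \<open>x \<in> pverts G\<close> assms(4)] .
  then have "awalk y ((y, x) # p) w"
    using assms(1) by (simp add: awalk_Cons_iff)
  then show "graph_dist G y w \<le> Suc (graph_dist G x w)"
    using graph_dist_le[of y _ w] p(2) by (metis length_Cons)
  obtain q where q: "awalk y q w" "length q = graph_dist G y w"
    using shortest_awalk[OF \<open>y \<in> pverts G\<close> assms(4)] .
  obtain r where "awalk x r w" "length r < length q"
    using awalk_through_bridge[OF q(1) assms(2,3) bridge] .
  then show "Suc (graph_dist G x w) \<le> graph_dist G y w"
    using graph_dist_le[of x r w] q(2) by simp
qed

text \<open>
  Applied with \<open>X\<close> and with its complement, the previous lemma compares all distances from \<open>y\<close>
  with those from \<open>x\<close>; summation leaves only the sizes of the two sides.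
\<close>

lemma transmission_across_bridge:
  assumes "(x, y) \<in> parcs G" "x \<in> X" "y \<notin> X" "X \<subseteq> pverts G"
    and bridge: "\<And>a b. (a, b) \<in> parcs G \<Longrightarrow> a \<in> X \<Longrightarrow> b \<notin> X \<Longrightarrow> a = x \<and> b = y"
  shows "int (transmission G y) = int (transmission G x) + 2 * int (card X) - int (card (pverts G))"
proof -
  let ?Y = "pverts G - X"
  have split: "(\<Sum>w\<in>pverts G. f w) = (\<Sum>w\<in>X. f w) + (\<Sum>w\<in>?Y. f w)" for f :: "'a \<Rightarrow> nat"
    using sum.subset_diff[OF assms(4) pair_finite_verts] by (simp add: add.commute)
  have "graph_dist G y w = Suc (graph_dist G x w)" if "w \<in> X" for w
  proof (rule graph_dist_across_bridge)
    show "b = x" if "(a, b) \<in> parcs G" "a \<notin> X" "b \<in> X" for a b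
      using bridge[OF parcs_sym[OF that(1)]] that by simp
  qed (use that assms(1-4) parcs_sym in auto)
  moreover have "graph_dist G x w = Suc (graph_dist G y w)" if "w \<in> ?Y" for w
  proof (rule graph_dist_across_bridge)
    show "b = y" if "(a, b) \<in> parcs G" "a \<notin> ?Y" "b \<in> ?Y" for a b
      using bridge[OF that(1)] that wellformed'(1)[OF that(1)] by simp
  qed (use that assms(1-4) in auto)
  ultimately have "transmission G y + card ?Y = transmission G x + card X"
    unfolding transmission_def split by (simp add: sum.distrib sum_Suc)
  moreover have "card (pverts G) = card X + card ?Y"
    using split[of "\<lambda>_. 1"] by simp
  ultimately show ?thesis
    by linarith
qed

end

section \<open>Segments: paths with inner vertices of degree 2\<close>

text \<open>
  Pendent paths and the path between the two hubs are both of this kind. Excluding degree 2 at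
  the ends makes a segment maximal, so that it is determined by any of its steps.
\<close>

definition segment :: "'a pair_pre_digraph \<Rightarrow> 'a list \<Rightarrow> bool" where
  "segment G p \<longleftrightarrow> vpath p (with_proj G) \<and> 2 \<le> length p \<and>
     (\<forall>x\<in>set (butlast (tl p)). degree G x = 2) \<and> degree G (hd p) \<noteq> 2 \<and> degree G (last p) \<noteq> 2"

lemma ball_inner_conv_nth:
  "(\<forall>x\<in>set (butlast (tl p)). P x) \<longleftrightarrow> (\<forall>i. 0 < i \<longrightarrow> Suc i < length p \<longrightarrow> P (p ! i))"
proof -
  have "set (butlast (tl p)) = {p ! i | i. 0 < i \<and> Suc i < length p}"
  proof (intro set_eqI iffI)
    fix x assume "x \<in> set (butlast (tl p))"
    then obtain k where "k < length (butlast (tl p))" "x = butlast (tl p) ! k"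
      by (metis in_set_conv_nth)
    then have "x = p ! Suc k" "Suc (Suc k) < length p"
      by (auto simp: nth_butlast nth_tl)
    then show "x \<in> {p ! i | i. 0 < i \<and> Suc i < length p}"
      by blast
  next
    fix x assume "x \<in> {p ! i | i. 0 < i \<and> Suc i < length p}"
    then obtain i where i: "x = p ! i" "0 < i" "Suc i < length p"
      by blast
    then have "x = butlast (tl p) ! (i - 1)" "i - 1 < length (butlast (tl p))"
      by (auto simp: nth_butlast nth_tl)
    then show "x \<in> set (butlast (tl p))"
      by simp
  qed
  then show ?thesis
    by auto
qed

lemma segment_conv_nth:
  "segment G p \<longleftrightarrow> 2 \<le> length p \<and> set p \<subseteq> pverts G \<and> distinct p \<and>
     (\<forall>i. Suc i < length p \<longrightarrow> (p ! i, p ! Suc i) \<in> parcs G) \<and>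
     (\<forall>i. 0 < i \<longrightarrow> Suc i < length p \<longrightarrow> degree G (p ! i) = 2) \<and>
     degree G (p ! 0) \<noteq> 2 \<and> degree G (p ! (length p - 1)) \<noteq> 2"
proof (cases "2 \<le> length p")
  case True
  then have "p \<noteq> []"
    by auto
  then show ?thesis
    by (auto simp: segment_def vpath_nth ball_inner_conv_nth hd_conv_nth last_conv_nth)
qed (simp add: segment_def)

lemma pendent_path_segment: "pendent_path G u p \<Longrightarrow> segment G p"
  by (auto simp: pendent_path_def segment_def)

lemma pendent_path_last: "pendent_path G u p \<Longrightarrow> degree G (last p) = 1"
  by (simp add: pendent_path_def)

lemma pendent_path_nth_0: "pendent_path G u p \<Longrightarrow> p ! 0 = u"
  by (metis pendent_path_def hd_conv_nth list.size(3) not_numeral_le_zero)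

lemma degree_1_unique:
  assumes "degree G x = 1" "(x, a) \<in> parcs G" "(x, b) \<in> parcs G"
  shows "a = b"
  using assms unfolding pair_out_degree by (metis card_1_singletonE mem_Collect_eq singletonD)

context connected_pair_graph
begin

lemma segment_rev:
  assumes "segment G p"
  shows "segment G (rev p)"
proof -
  note p = assms[unfolded segment_conv_nth]
  have "(rev p ! i, rev p ! Suc i) \<in> parcs G" if "Suc i < length p" for i
  proof -
    have "Suc (length p - Suc (Suc i)) = length p - Suc i"
      using that by simp
    then have "(p ! (length p - Suc (Suc i)), p ! (length p - Suc i)) \<in> parcs G"
      using p that by (metis Suc_less_eq diff_less_Suc diff_Suc_less length_greater_0_conv list.size(3) not_less_zero)
    then show ?thesis
      using that by (simp add: rev_nth parcs_sym)
  qed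
  moreover have "degree G (rev p ! i) = 2" if "0 < i" "Suc i < length p" for i
  proof -
    have "0 < length p - Suc i" "Suc (length p - Suc i) < length p"
      using that by auto
    then show ?thesis
      using p that by (simp add: rev_nth)
  qed
  moreover have "rev p ! 0 = p ! (length p - 1)" "rev p ! (length p - 1) = p ! 0"
    using order_less_le_trans[OF _ conjunct1[OF p], of 0] by (simp_all add: rev_nth)
  ultimately show ?thesis
    using p unfolding segment_conv_nth by simp
qed

lemma segment_arc_forward: "segment G p \<Longrightarrow> Suc i < length p \<Longrightarrow> (p ! i, p ! Suc i) \<in> parcs G"
  by (simp add: segment_conv_nth)

lemma segment_arc_backward:
  assumes "segment G p" "0 < i" "i < length p"
  shows "(p ! i, p ! (i - 1)) \<in> parcs G"
  using segment_arc_forward[of p "i - 1"] assms by (auto intro: parcs_sym)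

lemma segment_inner_neighbour:
  assumes "segment G p" "0 < i" "Suc i < length p" "(p ! i, b) \<in> parcs G"
  shows "b = p ! (i - 1) \<or> b = p ! Suc i"
proof -
  note p = assms(1)[unfolded segment_conv_nth]
  have "(p ! i, p ! (i - 1)) \<in> parcs G"
    using segment_arc_backward assms by simp
  moreover have "(p ! i, p ! Suc i) \<in> parcs G" "degree G (p ! i) = 2"
    using p assms(2,3) by auto
  moreover have "p ! (i - 1) \<noteq> p ! Suc i"
    using p assms(2,3) by (simp add: nth_eq_iff_index_eq)
  ultimately show ?thesis
    using deg2_step assms(4) by metis
qed

lemma segment_drop_eq:
  assumes r: "segment G r" and s: "segment G s"
    and "Suc i < length r" "Suc j < length s" "r ! i = s ! j" "r ! Suc i = s ! Suc j"
  shows "drop i r = drop j s"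
proof -
  have *: "vpath (drop k p) (with_proj G) \<and> 2 \<le> length (drop k p) \<and>
      (\<forall>x\<in>set (butlast (tl (drop k p))). degree G x = 2) \<and> degree G (last (drop k p)) \<noteq> 2"
    if "segment G p" "Suc k < length p" for k p
  proof -
    have p: "2 \<le> length p" "set p \<subseteq> pverts G" "distinct p"
      "\<And>i. Suc i < length p \<Longrightarrow> (p ! i, p ! Suc i) \<in> parcs G"
      "\<And>i. 0 < i \<Longrightarrow> Suc i < length p \<Longrightarrow> degree G (p ! i) = 2"
      "degree G (p ! (length p - 1)) \<noteq> 2"
      using that(1) unfolding segment_conv_nth by blast+
    have "set (drop k p) \<subseteq> pverts G"
      using p(2) set_drop_subset by fast
    moreover have "last (drop k p) = p ! (length p - 1)"
      using that(2) by (simp add: last_conv_nth)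
    ultimately show ?thesis
      unfolding vpath_nth ball_inner_conv_nth using p(1,3-) that(2) by auto
  qed
  show ?thesis
    using *[OF r assms(3)] *[OF s assms(4)] assms(3-)
    by (intro branch_unique[OF sym_parcs]) auto
qed

text \<open>
  A common step at inner vertices determines both segments forwards; backwards it leaves
  only one other neighbour, so that the reversed segments have a common step as well.
\<close>

lemma segment_eqI_step:
  assumes r: "segment G r" and s: "segment G s"
    and i: "0 < i" "Suc i < length r" and j: "0 < j" "Suc j < length s"
    and eq: "r ! i = s ! j" "r ! Suc i = s ! Suc j"
  shows "r = s"
proof -
  note S = s[unfolded segment_conv_nth]
  have tails: "drop i r = drop j s"
    using segment_drop_eq[OF r s i(2) j(2) eq] .
  have "(r ! i, s ! (j - 1)) \<in> parcs G"
    using segment_arc_backward[OF s j(1)] j(2) eq(1) by simp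
  moreover have "s ! (j - 1) \<noteq> r ! Suc i"
    using S j eq(2) by (simp add: nth_eq_iff_index_eq)
  ultimately have "r ! (i - 1) = s ! (j - 1)"
    using segment_inner_neighbour[OF r i] by metis
  then have "drop (length r - Suc i) (rev r) = drop (length s - Suc j) (rev s)"
    using i j eq(1)
    by (intro segment_drop_eq[OF segment_rev[OF r] segment_rev[OF s]]) (auto simp: rev_nth Suc_diff_Suc)
  then have "take (Suc i) r = take (Suc j) s"
    using i j by (simp add: drop_rev)
  moreover from this have "i = j"
    using i j by (metis Suc_inject length_take min.absorb4)
  ultimately show ?thesis
    using tails by (metis append_take_drop_id drop_Suc tl_drop)
qed

lemma segments_sharing_inner_vertex:
  assumes r: "segment G r" and s: "segment G s"
    and i: "0 < i" "Suc i < length r" and j: "0 < j" "Suc j < length s" and eq: "r ! i = s ! j"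
  shows "s = r \<or> s = rev r"
proof -
  have "(r ! i, s ! Suc j) \<in> parcs G"
    using segment_arc_forward[OF s j(2)] eq by simp
  then consider "s ! Suc j = r ! (i - 1)" | "s ! Suc j = r ! Suc i"
    using segment_inner_neighbour[OF r i] by blast
  then show ?thesis
  proof cases
    case 1
    then have "rev r = s"
      using i j eq
      by (intro segment_eqI_step[OF segment_rev[OF r] s, of "length r - Suc i" j])
        (auto simp: rev_nth Suc_diff_Suc)
    then show ?thesis
      by simp
  next
    case 2
    then show ?thesis
      using segment_eqI_step[OF r s i j eq] by simp
  qed
qed

text \<open>
  A common vertex of degree 2 would be an inner vertex of both segments and force them to
  coincide up to direction; a vertex of another degree can only be an end.
\<close>

lemma segments_meet_at_ends:
  assumes r: "segment G r" and s: "segment G s" and "s \<noteq> r" "s \<noteq> rev r"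
    and x: "x \<in> set r" "x \<in> set s"
  shows "x \<in> {hd r, last r} \<and> x \<in> {hd s, last s}"
proof -
  have inner: "x \<in> {hd p, last p} \<or> degree G x = 2 \<and> (\<exists>k. 0 < k \<and> Suc k < length p \<and> p ! k = x)"
    and ends: "x \<in> {hd p, last p} \<Longrightarrow> degree G x \<noteq> 2"
    if p: "segment G p" "x \<in> set p" for p
  proof -
    obtain k where k: "k < length p" "p ! k = x"
      using p(2) by (metis in_set_conv_nth)
    have "p \<noteq> []"
      using k by auto
    then consider "x = hd p" | "x = last p" | "0 < k" "Suc k < length p"
      using k by (metis One_nat_def Suc_lessI diff_Suc_1 hd_conv_nth last_conv_nth not_gr_zero)
    then show "x \<in> {hd p, last p} \<or> degree G x = 2 \<and> (\<exists>k. 0 < k \<and> Suc k < length p \<and> p ! k = x)"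
      using p(1) k unfolding segment_conv_nth by cases auto
    show "x \<in> {hd p, last p} \<Longrightarrow> degree G x \<noteq> 2"
      using p(1) by (auto simp: segment_def)
  qed
  have "degree G x \<noteq> 2"
  proof
    assume "degree G x = 2"
    then obtain i j where "0 < i" "Suc i < length r" "r ! i = x" "0 < j" "Suc j < length s" "s ! j = x"
      using inner[OF r x(1)] ends[OF r x(1)] inner[OF s x(2)] ends[OF s x(2)] by auto
    then show False
      using segments_sharing_inner_vertex[OF r s] assms(3,4) by metis
  qed
  then show ?thesis
    using inner[OF r x(1)] inner[OF s x(2)] by blast
qed

text \<open>
  The only edge at the leaf is the first step of both reversed segments.
\<close>

lemma segments_sharing_leaf:
  assumes r: "segment G r" and s: "segment G s" and "last r = last s" "degree G (last r) = 1"
  shows "r = s"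
proof -
  note R = segment_rev[OF r, unfolded segment_conv_nth] and S = segment_rev[OF s, unfolded segment_conv_nth]
  have "r \<noteq> []" "s \<noteq> []"
    using r s by (auto simp: segment_def)
  then have 0: "rev r ! 0 = last r" "rev s ! 0 = last s"
    by (simp_all add: rev_nth last_conv_nth)
  have "(last r, rev r ! 1) \<in> parcs G" "(last r, rev s ! 1) \<in> parcs G"
    using segment_arc_forward[OF segment_rev[OF r], of 0] segment_arc_forward[OF segment_rev[OF s], of 0]
      R S 0 assms(3) by simp_all
  then have "rev r ! 1 = rev s ! 1"
    using degree_1_unique assms(4) by metis
  then have "drop 0 (rev r) = drop 0 (rev s)"
    using R S 0 assms(3) by (intro segment_drop_eq[OF segment_rev[OF r] segment_rev[OF s]]) auto
  then show ?thesis
    by simp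
qed

end

section \<open>Pendent paths and hubs\<close>

text \<open>
  Both the transmissions along a pendent path and those along the path between the hubs grow
  by \<open>2i + 1 + m\<close> for some \<open>m\<close> from position \<open>i\<close> to \<open>i + 1\<close>; this is the sum of these increments.
\<close>

definition arm :: "int \<Rightarrow> nat \<Rightarrow> int" where
  "arm m i = int i * (int i + m)"

lemma arm_0 [simp]: "arm m 0 = 0"
  by (simp add: arm_def)

lemma arm_Suc: "arm m (Suc i) = arm m i + 2 * int i + 1 + m"
  by (simp add: arm_def algebra_simps)

text \<open>
  The transmissions minus that of the hub \<open>u\<close>: first along the path from \<open>u\<close> to \<open>v\<close>, then
  along the four pendent paths without their hubs.
\<close>

definition relative_transmissions :: "nat \<Rightarrow> nat \<Rightarrow> nat \<Rightarrow> nat \<Rightarrow> nat \<Rightarrow> int list" where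
  "relative_transmissions C A\<^sub>1 A\<^sub>2 B\<^sub>1 B\<^sub>2 =
     (let n = int (C + 1 + A\<^sub>1 + A\<^sub>2 + B\<^sub>1 + B\<^sub>2);
          spine = arm (2 * int (A\<^sub>1 + A\<^sub>2) - n + 1);
          leg = (\<lambda>l. map (arm (n - 2 * int l - 1)) [1..<Suc l])
      in map spine [0..<Suc C] @ leg A\<^sub>1 @ leg A\<^sub>2 @ map ((+) (spine C)) (leg B\<^sub>1 @ leg B\<^sub>2))"

context connected_pair_graph
begin

lemma pendent_path_neighbour:
  assumes p: "pendent_path G u p" and i: "0 < i" "i < length p" and arc: "(p ! i, b) \<in> parcs G"
  shows "b = p ! (i - 1) \<or> Suc i < length p \<and> b = p ! Suc i"
proof (cases "Suc i < length p")
  case True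
  then show ?thesis
    using segment_inner_neighbour[OF pendent_path_segment[OF p] i(1) _ arc] by blast
next
  case False
  then have "i = length p - 1" "p \<noteq> []"
    using i by auto
  then have "degree G (p ! i) = 1"
    using pendent_path_last[OF p] by (simp add: last_conv_nth)
  then show ?thesis
    using degree_1_unique[OF _ arc] segment_arc_backward[OF pendent_path_segment[OF p] i] by blast
qed

lemma pendent_path_arc_closed:
  assumes p: "pendent_path G u p" and a: "a \<in> set p" "a \<noteq> u" and arc: "(a, b) \<in> parcs G"
  shows "b \<in> set p"
proof -
  obtain i where i: "i < length p" "a = p ! i"
    using a(1) by (metis in_set_conv_nth)
  then have "0 < i"
    using a(2) pendent_path_nth_0[OF p] by (metis not_gr_zero)
  then show ?thesis
    using pendent_path_neighbour[OF p _ i(1), of b] arc i by (auto simp: less_imp_diff_less)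
qed

text \<open>
  The edge between positions \<open>i\<close> and \<open>i + 1\<close> is a bridge that cuts off the remaining vertices of
  the path. They are on the side of position \<open>i + 1\<close>, so the bridge is crossed from there.
\<close>

lemma transmission_pendent_path:
  assumes p: "pendent_path G u p" and "i < length p"
  shows "int (transmission G (p ! i)) =
    int (transmission G u) + arm (int (card (pverts G)) - 2 * int (length p - 1) - 1) i"
  using assms(2)
proof (induction i)
  case 0
  then show ?case
    using pendent_path_nth_0[OF p] by simp
next
  case (Suc i)
  note P = pendent_path_segment[OF p, unfolded segment_conv_nth]
  have mem: "p ! k \<in> set (drop (Suc i) p) \<longleftrightarrow> Suc i \<le> k" if "k < length p" for k
  proof
    assume "p ! k \<in> set (drop (Suc i) p)"
    then obtain j where "j < length p - Suc i" "p ! k = p ! (Suc i + j)"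
      by (auto simp: in_set_conv_nth)
    then show "Suc i \<le> k"
      using P that by (simp add: nth_eq_iff_index_eq)
  next
    assume "Suc i \<le> k"
    then show "p ! k \<in> set (drop (Suc i) p)"
      using that by (auto simp: in_set_conv_nth intro!: exI[of _ "k - Suc i"])
  qed
  have "int (transmission G (p ! i)) =
    int (transmission G (p ! Suc i)) + 2 * int (card (set (drop (Suc i) p))) - int (card (pverts G))"
  proof (rule transmission_across_bridge)
    fix a b
    assume ab: "(a, b) \<in> parcs G" "a \<in> set (drop (Suc i) p)" "b \<notin> set (drop (Suc i) p)"
    then obtain k where k: "k < length p" "a = p ! k"
      by (metis in_set_conv_nth in_set_dropD)
    then have le: "Suc i \<le> k"
      using mem ab(2) by blast
    then have "b = p ! (k - 1)"
      using pendent_path_neighbour[OF p _ k(1), of b] ab(1,3) k mem[of "Suc k"] by auto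
    moreover from this have "k - 1 < Suc i"
      using mem[of "k - 1"] k ab(3) by auto
    then have "k = Suc i"
      using le by simp
    ultimately show "a = p ! Suc i \<and> b = p ! i"
      using k by simp
  next
    show "set (drop (Suc i) p) \<subseteq> pverts G"
      using P set_drop_subset[of "Suc i" p] by blast
    show "(p ! Suc i, p ! i) \<in> parcs G"
      using segment_arc_backward[OF pendent_path_segment[OF p] _ Suc.prems] by simp
  qed (use mem Suc.prems in auto)
  moreover have "card (set (drop (Suc i) p)) = length p - Suc i"
    using P by (simp add: distinct_card)
  ultimately show ?case
    using Suc by (simp add: arm_Suc)
qed

text \<open>
  Segments that leave the hub by the same edge are equal, so the three segments use up
  the degree of the hub.
\<close>

lemma hub_neighbour:
  assumes p: "pendent_path G u p" and q: "pendent_path G u q" and "p \<noteq> q"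
    and s: "segment G s" "s ! 0 = u" "degree G (last s) \<noteq> 1"
    and "degree G u = 3" and arc: "(u, b) \<in> parcs G"
  shows "b \<in> {p ! 1, q ! 1, s ! 1}"
proof -
  have eq: "r = r'" if "segment G r" "segment G r'" "r ! 0 = u" "r' ! 0 = u" "r ! 1 = r' ! 1" for r r'
  proof -
    have "drop 0 r = drop 0 r'"
      using that by (intro segment_drop_eq) (auto simp: segment_def)
    then show ?thesis
      by simp
  qed
  note P = pendent_path_segment[OF p] pendent_path_nth_0[OF p] pendent_path_last[OF p]
    and Q = pendent_path_segment[OF q] pendent_path_nth_0[OF q] pendent_path_last[OF q]
  have "p ! 1 \<noteq> q ! 1" "p ! 1 \<noteq> s ! 1" "q ! 1 \<noteq> s ! 1"
    using eq P Q s assms(3) by metis+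
  then have "card {p ! 1, q ! 1, s ! 1} = 3"
    by simp
  moreover have "{p ! 1, q ! 1, s ! 1} \<subseteq> {y. (u, y) \<in> parcs G}"
    using segment_arc_forward[OF P(1), of 0] segment_arc_forward[OF Q(1), of 0]
      segment_arc_forward[OF s(1), of 0] P Q s by (auto simp: segment_def)
  moreover have card: "card {y. (u, y) \<in> parcs G} = 3"
    using assms(7) by (simp add: pair_out_degree)
  moreover have "finite {y. (u, y) \<in> parcs G}"
    using card by (metis card.infinite zero_neq_numeral)
  ultimately have "{p ! 1, q ! 1, s ! 1} = {y. (u, y) \<in> parcs G}"
    by (intro card_subset_eq) auto
  then show ?thesis
    using arc by blast
qed

text \<open>
  By \<open>segments_meet_at_ends\<close> a common vertex is an end of both paths. It is not a leaf, since a
  leaf is no hub and belongs to one pendent path only.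
\<close>

lemma pendent_paths_meet:
  assumes p: "pendent_path G u p" and q: "pendent_path G w q" and "p \<noteq> q" and x: "x \<in> set p" "x \<in> set q"
  shows "x = u \<and> x = w"
proof -
  have P: "hd p = u" "2 < degree G u" "degree G (last p) = 1" "p \<noteq> []"
    and Q: "hd q = w" "2 < degree G w" "degree G (last q) = 1" "q \<noteq> []"
    using p q by (auto simp: pendent_path_def)
  then have "q \<noteq> rev p"
    by (auto simp: last_rev)
  then have "x \<in> {u, last p} \<and> x \<in> {w, last q}"
    using segments_meet_at_ends[OF pendent_path_segment[OF p] pendent_path_segment[OF q]] assms(3) x P Q
    by metis
  moreover have "last p \<noteq> last q"
    using segments_sharing_leaf[OF pendent_path_segment[OF p] pendent_path_segment[OF q]] assms(3) P by auto
  ultimately show ?thesis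
    using P Q by auto
qed

lemma pendent_path_meets_segment:
  assumes p: "pendent_path G u p" and s: "segment G s" "degree G (hd s) \<noteq> 1" "degree G (last s) \<noteq> 1"
    and x: "x \<in> set p" "x \<in> set s"
  shows "x = u"
proof -
  have P: "hd p = u" "degree G (last p) = 1" "p \<noteq> []"
    using p by (auto simp: pendent_path_def)
  then have "s \<noteq> rev p" "s \<noteq> p"
    using s by (auto simp: hd_rev)
  then have "x \<in> {u, last p} \<and> x \<in> {hd s, last s}"
    using segments_meet_at_ends[OF pendent_path_segment[OF p] s(1)] x P by metis
  then show ?thesis
    using P s by auto
qed

end

section \<open>The transmissions of an H-tree\<close>

text \<open>
  An H-tree with its five paths named. The spine \<open>S\<close> between the hubs has to be a segment, so that
  no other edge leaves its inner vertices.
\<close>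

locale H_tree = connected_pair_graph +
  fixes u v :: 'a and P\<^sub>1 P\<^sub>2 Q\<^sub>1 Q\<^sub>2 S :: "'a list"
  assumes hubs: "u \<noteq> v" "degree G u = 3" "degree G v = 3"
    and P: "pendent_path G u P\<^sub>1" "pendent_path G u P\<^sub>2" "P\<^sub>1 \<noteq> P\<^sub>2"
    and Q: "pendent_path G v Q\<^sub>1" "pendent_path G v Q\<^sub>2" "Q\<^sub>1 \<noteq> Q\<^sub>2"
    and S: "segment G S" "hd S = u" "last S = v"
begin

lemma nonempty: "P\<^sub>1 \<noteq> []" "P\<^sub>2 \<noteq> []" "Q\<^sub>1 \<noteq> []" "Q\<^sub>2 \<noteq> []" "S \<noteq> []"
  using P Q S by (auto simp: pendent_path_def segment_def)

lemma spine_nth_ends: "S ! 0 = u" "S ! (length S - 1) = v"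
  using S nonempty by (simp_all add: hd_conv_nth last_conv_nth)

lemma hub_u_neighbour: "(u, b) \<in> parcs G \<Longrightarrow> b \<in> {P\<^sub>1 ! 1, P\<^sub>2 ! 1, S ! 1}"
  using hub_neighbour[OF P S(1) spine_nth_ends(1)] hubs S by simp

lemma hub_v_neighbour: "(v, b) \<in> parcs G \<Longrightarrow> b \<in> {Q\<^sub>1 ! 1, Q\<^sub>2 ! 1, rev S ! 1}"
  using hub_neighbour[OF Q segment_rev[OF S(1)]] hubs S nonempty
  by (simp add: rev_nth last_rev last_conv_nth)

text \<open>
  The union of the five paths contains all neighbours of its vertices: three at each hub by
  \<open>hub_neighbour\<close>, and elsewhere the adjacent vertices of the path.
\<close>

lemma pverts_eq: "pverts G = set P\<^sub>1 \<union> set P\<^sub>2 \<union> set S \<union> set Q\<^sub>1 \<union> set Q\<^sub>2" (is "_ = ?W")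
proof
  have len: "2 \<le> length P\<^sub>1" "2 \<le> length P\<^sub>2" "2 \<le> length Q\<^sub>1" "2 \<le> length Q\<^sub>2" "2 \<le> length S"
    using P Q S by (simp_all add: pendent_path_def segment_def)
  show "pverts G \<subseteq> ?W"
  proof (rule pverts_subset_if_arc_closed)
    show "u \<in> ?W"
      using S nonempty by auto
    show "u \<in> pverts G"
      using S(1) spine_nth_ends(1) nonempty nth_mem[of 0 S] by (auto simp: segment_conv_nth)
    fix a b assume arc: "(a, b) \<in> parcs G" and "a \<in> ?W"
    show "b \<in> ?W"
    proof -
      consider "a = u" | "a = v" | "a \<noteq> u" "a \<noteq> v" "a \<notin> set S" | "a \<noteq> u" "a \<noteq> v" "a \<in> set S"
        by blast
      then show ?thesis
      proof cases
        case 1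
        then show ?thesis
          using hub_u_neighbour[of b] arc len by auto
      next
        case 2
        have "rev S ! 1 \<in> set (rev S)"
          using len by (intro nth_mem) simp
        then show ?thesis
          using hub_v_neighbour[of b] 2 arc len by auto
      next
        case 3
        then show ?thesis
          using \<open>a \<in> ?W\<close> arc P Q pendent_path_arc_closed by blast
      next
        case 4
        then obtain i where i: "i < length S" "a = S ! i"
          by (metis in_set_conv_nth)
        have "i \<noteq> 0" "i \<noteq> length S - 1"
          using i 4 spine_nth_ends by metis+
        then have "0 < i" "Suc i < length S"
          using i by auto
        then show ?thesis
          using segment_inner_neighbour[OF S(1), of i b] arc i by (auto simp: less_imp_diff_less)
      qed
    qed
  qed
  show "?W \<subseteq> pverts G"
    using P Q S(1) by (auto simp: pendent_path_def vpath_nth segment_conv_nth)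
qed

lemma distinct_paths: "distinct P\<^sub>1" "distinct P\<^sub>2" "distinct Q\<^sub>1" "distinct Q\<^sub>2" "distinct S"
  using P Q S(1) by (auto simp: pendent_path_def vpath_nth segment_conv_nth)

lemma set_tl_paths:
  "set (tl P\<^sub>1) = set P\<^sub>1 - {u}" "set (tl P\<^sub>2) = set P\<^sub>2 - {u}"
  "set (tl Q\<^sub>1) = set Q\<^sub>1 - {v}" "set (tl Q\<^sub>2) = set Q\<^sub>2 - {v}"
proof -
  have *: "set (tl p) = set p - {w}" if "pendent_path G w p" for p w
    using that by (cases p) (auto simp: pendent_path_def vpath_nth)
  show "set (tl P\<^sub>1) = set P\<^sub>1 - {u}" "set (tl P\<^sub>2) = set P\<^sub>2 - {u}"
    "set (tl Q\<^sub>1) = set Q\<^sub>1 - {v}" "set (tl Q\<^sub>2) = set Q\<^sub>2 - {v}"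
    using * P Q by blast+
qed

lemma disjoint_paths:
  "set P\<^sub>1 \<inter> set P\<^sub>2 \<subseteq> {u}" "set Q\<^sub>1 \<inter> set Q\<^sub>2 \<subseteq> {v}"
  "(set P\<^sub>1 \<union> set P\<^sub>2) \<inter> (set Q\<^sub>1 \<union> set Q\<^sub>2) = {}"
  "(set P\<^sub>1 \<union> set P\<^sub>2) \<inter> set S \<subseteq> {u}" "(set Q\<^sub>1 \<union> set Q\<^sub>2) \<inter> set S \<subseteq> {v}"
proof -
  show "set P\<^sub>1 \<inter> set P\<^sub>2 \<subseteq> {u}" "set Q\<^sub>1 \<inter> set Q\<^sub>2 \<subseteq> {v}"
    using pendent_paths_meet P Q by blast+
  have "x \<notin> set q" if "pendent_path G u p" "pendent_path G v q" "x \<in> set p" for p q x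
    using pendent_paths_meet[OF that(1,2)] that hubs(1) pendent_path_nth_0 by metis
  then show "(set P\<^sub>1 \<union> set P\<^sub>2) \<inter> (set Q\<^sub>1 \<union> set Q\<^sub>2) = {}"
    using P Q by blast
  have "x = w" if "pendent_path G w p" "x \<in> set p" "x \<in> set S" for p w x
    using pendent_path_meets_segment[OF that(1) S(1)] that S hubs by simp
  then show "(set P\<^sub>1 \<union> set P\<^sub>2) \<inter> set S \<subseteq> {u}" "(set Q\<^sub>1 \<union> set Q\<^sub>2) \<inter> set S \<subseteq> {v}"
    using P Q by blast+
qed

abbreviation vertex_list :: "'a list" where
  "vertex_list \<equiv> S @ tl P\<^sub>1 @ tl P\<^sub>2 @ tl Q\<^sub>1 @ tl Q\<^sub>2"

lemma set_vertex_list: "set vertex_list = pverts G"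
proof -
  have "u \<in> set S" "v \<in> set S"
    using S nonempty by auto
  then show ?thesis
    unfolding pverts_eq by (auto simp: set_tl_paths)
qed

lemma distinct_vertex_list: "distinct vertex_list"
proof -
  have "u \<in> set S" "v \<in> set S"
    using S nonempty by auto
  then show ?thesis
    using disjoint_paths distinct_paths by (auto simp: set_tl_paths distinct_tl)
qed

lemma card_pverts:
  "card (pverts G) = length S + (length P\<^sub>1 - 1) + (length P\<^sub>2 - 1) + (length Q\<^sub>1 - 1) + (length Q\<^sub>2 - 1)"
  using distinct_card[OF distinct_vertex_list] unfolding set_vertex_list by simp

text \<open>
  The edge between positions \<open>i\<close> and \<open>i + 1\<close> separates the pendent paths at \<open>u\<close> and the first
  \<open>i + 1\<close> vertices of the spine from the rest.
\<close>

lemma transmission_spine: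
  assumes "i < length S"
  shows "int (transmission G (S ! i)) = int (transmission G u) +
    arm (2 * int (length P\<^sub>1 - 1 + (length P\<^sub>2 - 1)) - int (card (pverts G)) + 1) i"
  using assms
proof (induction i)
  case 0
  then show ?case
    using spine_nth_ends by simp
next
  case (Suc i)
  let ?X = "set (tl P\<^sub>1 @ tl P\<^sub>2 @ take (Suc i) S)"
  have mem: "S ! k \<in> ?X \<longleftrightarrow> k \<le> i" if "k < length S" for k
  proof -
    have "S ! k \<notin> set (tl P\<^sub>1)" "S ! k \<notin> set (tl P\<^sub>2)"
      using disjoint_paths(4) that nth_mem[OF that] by (auto simp: set_tl_paths)
    moreover have "S ! k \<in> set (take (Suc i) S) \<longleftrightarrow> k \<le> i"
      using that distinct_paths(5) by (auto simp: in_set_conv_nth nth_eq_iff_index_eq)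
    ultimately show ?thesis
      by simp
  qed
  have "u \<in> ?X"
    using mem[of 0] spine_nth_ends nonempty by simp
  have "distinct (tl P\<^sub>1 @ tl P\<^sub>2 @ take (Suc i) S)"
    using distinct_vertex_list by (auto dest: in_set_takeD)
  from distinct_card[OF this]
  have card: "card ?X = (length P\<^sub>1 - 1) + (length P\<^sub>2 - 1) + Suc i"
    using Suc.prems by simp
  have "int (transmission G (S ! Suc i)) =
    int (transmission G (S ! i)) + 2 * int (card ?X) - int (card (pverts G))"
  proof (rule transmission_across_bridge)
    show "?X \<subseteq> pverts G"
      unfolding pverts_eq by (auto simp: set_tl_paths dest: in_set_takeD)
    show "(S ! i, S ! Suc i) \<in> parcs G"
      using segment_arc_forward S(1) Suc.prems by blast
    fix a b
    assume ab: "(a, b) \<in> parcs G" "a \<in> ?X" "b \<notin> ?X"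
    have "a \<notin> set (tl P\<^sub>1)" "a \<notin> set (tl P\<^sub>2)"
      using pendent_path_arc_closed[OF P(1) _ _ ab(1)] pendent_path_arc_closed[OF P(2) _ _ ab(1)]
        ab(3) \<open>u \<in> ?X\<close> by (auto simp: set_tl_paths)
    then obtain k where k: "k < length S" "k \<le> i" "a = S ! k"
      using ab(2) by (auto simp: in_set_conv_nth)
    have "b = S ! Suc k"
    proof (cases "k = 0")
      case True
      have "P\<^sub>1 ! 1 \<in> set (tl P\<^sub>1)" "P\<^sub>2 ! 1 \<in> set (tl P\<^sub>2)"
        using P by (auto simp: pendent_path_def in_set_conv_nth nth_tl intro!: exI[of _ 0])
      then show ?thesis
        using hub_u_neighbour[of b] ab True k spine_nth_ends by auto
    next
      case False
      have "S ! (k - 1) \<in> ?X"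
        using mem[of "k - 1"] k by simp
      then show ?thesis
        using segment_inner_neighbour[OF S(1), of k b] False ab(1,3) k Suc.prems by auto
    qed
    moreover from this have "k = i"
      using mem[of "Suc k"] ab(3) k Suc.prems by auto
    ultimately show "a = S ! i \<and> b = S ! Suc i"
      using k by simp
  qed (use mem Suc.prems in auto)
  then show ?case
    using Suc card by (simp add: arm_Suc)
qed

theorem map_transmission_vertex_list:
  "map (\<lambda>x. int (transmission G x) - int (transmission G u)) vertex_list =
   relative_transmissions (length S - 1) (length P\<^sub>1 - 1) (length P\<^sub>2 - 1) (length Q\<^sub>1 - 1) (length Q\<^sub>2 - 1)"
proof -
  let ?n = "int (card (pverts G))"
  let ?f = "\<lambda>x. int (transmission G x) - int (transmission G u)"
  let ?spine = "arm (2 * int (length P\<^sub>1 - 1 + (length P\<^sub>2 - 1)) - ?n + 1)"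
  have leg: "map ?f (tl p) = map (\<lambda>i. int (transmission G w) - int (transmission G u) + arm (?n - 2 * int (length p - 1) - 1) i)
      [1..<Suc (length p - 1)]" if "pendent_path G w p" for w p
    using transmission_pendent_path[OF that]
    by (intro nth_equalityI) (auto simp: nth_tl simp del: upt_Suc)
  have spine: "map ?f S = map ?spine [0..<Suc (length S - 1)]"
    using transmission_spine nonempty by (intro nth_equalityI) (auto simp del: upt_Suc)
  have v: "int (transmission G v) - int (transmission G u) = ?spine (length S - 1)"
    using transmission_spine[of "length S - 1"] spine_nth_ends nonempty by simp
  have n: "?n = int (length S - 1 + 1 + (length P\<^sub>1 - 1) + (length P\<^sub>2 - 1) + (length Q\<^sub>1 - 1) + (length Q\<^sub>2 - 1))"
    using card_pverts nonempty by (simp add: Suc_leI)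
  show ?thesis
    unfolding relative_transmissions_def Let_def n[symmetric] map_append
      leg[OF P(1)] leg[OF P(2)] leg[OF Q(1)] leg[OF Q(2)] spine v
    by (simp add: comp_def del: upt_Suc)
qed

end

text \<open>
  A shortest walk from \<open>u\<close> to \<open>v\<close> repeats no vertex, and its inner vertices have degree 2: at most 2
  because only the hubs have larger degree, at least 2 because of the predecessor and the
  successor.
\<close>

lemma is_H_tree_imp_H_tree:
  assumes "is_H_tree G C A\<^sub>1 A\<^sub>2 B\<^sub>1 B\<^sub>2"
  obtains u v P\<^sub>1 P\<^sub>2 Q\<^sub>1 Q\<^sub>2 S where "H_tree G u v P\<^sub>1 P\<^sub>2 Q\<^sub>1 Q\<^sub>2 S"
    "length P\<^sub>1 - 1 = A\<^sub>1" "length P\<^sub>2 - 1 = A\<^sub>2" "length Q\<^sub>1 - 1 = B\<^sub>1" "length Q\<^sub>2 - 1 = B\<^sub>2" "length S - 1 = C"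
proof -
  obtain u v P\<^sub>1 P\<^sub>2 Q\<^sub>1 Q\<^sub>2 where *: "simple_tree G" "u \<noteq> v" "{x \<in> pverts G. 2 < degree G x} = {u, v}"
      "degree G u = 3" "degree G v = 3" "graph_dist G u v = C"
      "P\<^sub>1 \<noteq> P\<^sub>2" "{r. pendent_path G u r} = {P\<^sub>1, P\<^sub>2}" "vwalk_length P\<^sub>1 = A\<^sub>1" "vwalk_length P\<^sub>2 = A\<^sub>2"
      "Q\<^sub>1 \<noteq> Q\<^sub>2" "{r. pendent_path G v r} = {Q\<^sub>1, Q\<^sub>2}" "vwalk_length Q\<^sub>1 = B\<^sub>1" "vwalk_length Q\<^sub>2 = B\<^sub>2"
    using assms unfolding is_H_tree_def by blast
  then interpret pair_graph G
    by (simp add: simple_tree_def)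
  interpret connected_pair_graph G
    using * by unfold_locales (simp add: simple_tree_def)
  have "u \<in> pverts G" "v \<in> pverts G"
    using *(3) by blast+
  then obtain p where p: "awalk u p v" "length p = C"
    using shortest_awalk *(6) by metis
  define S where "S = pawalk_verts u p"
  have ends: "hd S = u" "last S = v" and len: "length S = Suc C"
    using p by (auto simp: S_def awhd_of_awalk length_awalk_verts)
  have "distinct S"
  proof (rule ccontr)
    assume "\<not> distinct S"
    then obtain q r s w where "p = q @ r @ s" "0 < length r" "awalk u q w" "awalk w s v"
      using awalk_not_distinct_decomp[OF p(1)] unfolding S_def by metis
    then have "p = q @ r @ s" "0 < length r" "awalk u (q @ s) v"
      using awalk_appendI by auto
    then have "length (q @ s) < length p" "awalk u (q @ s) v"
      by simp_all
    then show False
      using graph_dist_le[of u "q @ s" v] p(2) *(6) by linarith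
  qed
  moreover have "vwalk S (with_proj G)"
    using awalk_imp_vwalk[OF p(1)] by (simp add: S_def)
  ultimately have vpath: "vpath S (with_proj G)"
    by (simp add: vpath_def)
  then have S: "set S \<subseteq> pverts G" "S \<noteq> []" "distinct S"
      "\<And>i. Suc i < length S \<Longrightarrow> (S ! i, S ! Suc i) \<in> parcs G"
    by (auto simp: vpath_nth)
  have 0: "S ! 0 = u" "S ! (length S - 1) = v"
    using ends S by (simp_all add: hd_conv_nth last_conv_nth)
  have "2 \<le> length S"
    using 0 *(2) S(2) by (cases "length S = 1") (auto simp: Suc_le_eq numeral_2_eq_2 neq_Nil_conv)
  moreover have "degree G (S ! i) = 2" if i: "0 < i" "Suc i < length S" for i
  proof -
    have "S ! i \<noteq> S ! 0" "S ! i \<noteq> S ! (length S - 1)"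
      using S(2,3) i by (simp_all add: nth_eq_iff_index_eq)
    then have "S ! i \<notin> {u, v}"
      using 0 by simp
    moreover have "S ! i \<in> pverts G"
      using S(1) i by auto
    ultimately have "degree G (S ! i) \<le> 2"
      using *(3) by (metis (mono_tags, lifting) leI mem_Collect_eq)
    moreover have "2 \<le> degree G (S ! i)"
    proof -
      have "{y. (S ! i, y) \<in> parcs G} \<subseteq> pverts G"
        by (auto dest: wellformed')
      then have "finite {y. (S ! i, y) \<in> parcs G}"
        using pair_finite_verts finite_subset by blast
      moreover have "{S ! (i - 1), S ! Suc i} \<subseteq> {y. (S ! i, y) \<in> parcs G}"
        using S(4)[of "i - 1"] S(4)[of i] i parcs_sym by auto
      moreover have "card {S ! (i - 1), S ! Suc i} = 2"
        using S(3) i by (simp add: nth_eq_iff_index_eq)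
      ultimately show ?thesis
        unfolding pair_out_degree by (metis card_mono)
    qed
    ultimately show ?thesis
      by simp
  qed
  ultimately have "segment G S"
    using S 0 *(4,5) unfolding segment_conv_nth by simp
  then have "H_tree G u v P\<^sub>1 P\<^sub>2 Q\<^sub>1 Q\<^sub>2 S"
    using * ends by unfold_locales auto
  then show thesis
    using that * len by simp
qed

theorem transmission_irregular_if_distinct:
  assumes "is_H_tree G C A\<^sub>1 A\<^sub>2 B\<^sub>1 B\<^sub>2" and "distinct (relative_transmissions C A\<^sub>1 A\<^sub>2 B\<^sub>1 B\<^sub>2)"
  shows "transmission_irregular G"
proof -
  obtain u v P\<^sub>1 P\<^sub>2 Q\<^sub>1 Q\<^sub>2 S where H: "H_tree G u v P\<^sub>1 P\<^sub>2 Q\<^sub>1 Q\<^sub>2 S"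
    and len: "length P\<^sub>1 - 1 = A\<^sub>1" "length P\<^sub>2 - 1 = A\<^sub>2" "length Q\<^sub>1 - 1 = B\<^sub>1" "length Q\<^sub>2 - 1 = B\<^sub>2" "length S - 1 = C"
    using is_H_tree_imp_H_tree[OF assms(1)] .
  interpret H_tree G u v P\<^sub>1 P\<^sub>2 Q\<^sub>1 Q\<^sub>2 S
    by (rule H)
  have "distinct (map (\<lambda>x. int (transmission G x) - int (transmission G u)) vertex_list)"
    unfolding map_transmission_vertex_list len by (rule assms(2))
  then have "inj_on (\<lambda>x. int (transmission G x) - int (transmission G u)) (pverts G)"
    unfolding distinct_map set_vertex_list by blast
  then have "inj_on (transmission G) (pverts G)"
    by (auto simp: inj_on_def)
  then show ?thesis
    using connected pair_graph by (simp add: transmission_irregular_def)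
qed

section \<open>Interlacing of quadratic sequences\<close>

lemma arm_less: "0 \<le> m \<Longrightarrow> i < j \<Longrightarrow> arm m i < arm m j"
  by (rule lift_Suc_mono_less[where f = "arm m"]) (simp_all add: arm_Suc)

lemma arm_less_iff: "0 \<le> m \<Longrightarrow> arm m i < arm m j \<longleftrightarrow> i < j"
  using arm_less by (metis linorder_cases order_less_asym)

lemma arm_pos: "0 \<le> m \<Longrightarrow> 0 < i \<Longrightarrow> 0 < arm m i"
  using arm_less[of m 0 i] by simp

lemma inj_arm: "0 \<le> m \<Longrightarrow> inj (arm m)"
  by (rule injI) (metis arm_less linorder_cases order_less_irrefl)

lemma not_arm_if_between:
  assumes "0 \<le> m" "arm m a < z" "z < arm m (Suc a)"
  shows "z \<noteq> arm m j"
  using assms arm_less_iff[OF assms(1)] by (metis not_less_eq)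

text \<open>
  The number \<open>z\<close> lies in a gap of the chain
  \<open>arm m a \<le> arm (m + 2) a < arm m (a + 1) \<le> arm (m + 2) (a + 1) < \<dots>\<close>
  formed by the two pendent paths at \<open>u\<close>, continued beyond their actual lengths.
\<close>

definition between_arms :: "int \<Rightarrow> int \<Rightarrow> bool" where
  "between_arms m z \<longleftrightarrow>
     (\<exists>a. arm m a < z \<and> z < arm (m + 2) a \<or> arm (m + 2) a < z \<and> z < arm m (Suc a))"

lemma between_armsI_low: "arm m a < z \<Longrightarrow> z < arm (m + 2) a \<Longrightarrow> between_arms m z"
  and between_armsI_high: "arm (m + 2) a < z \<Longrightarrow> z < arm m (Suc a) \<Longrightarrow> between_arms m z"
  unfolding between_arms_def by blast+

lemma arms_interlace:
  assumes "0 \<le> m"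
  shows "arm m a \<le> arm (m + 2) a" "arm (m + 2) a < arm m (Suc a)"
  using assms by (simp_all add: arm_def algebra_simps)

lemma not_arm_if_between_arms:
  assumes "0 \<le> m" "between_arms m z"
  shows "z \<noteq> arm m j" "z \<noteq> arm (m + 2) j"
proof -
  note interlace = arms_interlace[OF assms(1)]
  obtain a where a: "arm m a < z \<and> z < arm (m + 2) a \<or> arm (m + 2) a < z \<and> z < arm m (Suc a)"
    using assms(2) unfolding between_arms_def by blast
  then have "arm m a < z" "z < arm m (Suc a)"
    using interlace[of a] by linarith+
  then show "z \<noteq> arm m j"
    using not_arm_if_between[OF assms(1)] by blast
  show "z \<noteq> arm (m + 2) j"
    using a
  proof
    \<comment> \<open>Here \<open>z\<close> lies between \<open>arm (m + 2) (a - 1)\<close> and \<open>arm (m + 2) a\<close>; at \<open>a = 0\<close> the gap is empty.\<close>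
    assume z: "arm m a < z \<and> z < arm (m + 2) a"
    then obtain a' where "a = Suc a'"
      by (cases a) auto
    then show ?thesis
      using not_arm_if_between[of "m + 2" a' z j] z interlace(2)[of a'] assms(1) by simp
  next
    assume "arm (m + 2) a < z \<and> z < arm m (Suc a)"
    then show ?thesis
      using not_arm_if_between[of "m + 2" a z j] interlace(1)[of "Suc a"] assms(1) by simp
  qed
qed

text \<open>
  The slopes \<open>m\<close> and \<open>m + 2\<close> belong to the pendent paths at \<open>u\<close>, \<open>e\<close> to the path from \<open>u\<close> to \<open>v\<close>,
  and \<open>b\<^sub>1\<close>, \<open>b\<^sub>2\<close> to the pendent paths at \<open>v\<close>. As all slopes are nonnegative, transmissions grow away
  from \<open>u\<close>; this separates the path between the hubs from the pendent paths at \<open>v\<close>, and the gap conditions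
  and the interlacing separate the remaining pairs.
\<close>

lemma distinct_relative_transmissions:
  assumes A: "A\<^sub>1 = Suc A\<^sub>2"
    and m: "m = int (C + B\<^sub>1 + B\<^sub>2) - 1" "0 \<le> m"
    and e: "e = 2 * int A\<^sub>2 + 1 - int (C + B\<^sub>1 + B\<^sub>2)" "0 \<le> e"
    and b\<^sub>1: "b\<^sub>1 = int (C + 1 + 2 * A\<^sub>2 + B\<^sub>2) - int B\<^sub>1" "0 \<le> b\<^sub>1"
    and b\<^sub>2: "b\<^sub>2 = int (C + 1 + 2 * A\<^sub>2 + B\<^sub>1) - int B\<^sub>2" "0 \<le> b\<^sub>2"
    and spine: "\<And>i. 0 < i \<Longrightarrow> i \<le> C \<Longrightarrow> between_arms m (arm e i)"
    and leg\<^sub>1: "\<And>k. 0 < k \<Longrightarrow> k \<le> B\<^sub>1 \<Longrightarrow> between_arms m (arm e C + arm b\<^sub>1 k)"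
    and leg\<^sub>2: "\<And>k. 0 < k \<Longrightarrow> k \<le> B\<^sub>2 \<Longrightarrow> between_arms m (arm e C + arm b\<^sub>2 k)"
    and legs: "\<And>k. 0 < k \<Longrightarrow> k \<le> B\<^sub>2 \<Longrightarrow> \<exists>a. arm b\<^sub>1 a < arm b\<^sub>2 k \<and> arm b\<^sub>2 k < arm b\<^sub>1 (Suc a)"
  shows "distinct (relative_transmissions C A\<^sub>1 A\<^sub>2 B\<^sub>1 B\<^sub>2)"
proof -
  let ?f = "\<lambda>k. arm e C + arm b\<^sub>1 k" and ?g = "\<lambda>k. arm e C + arm b\<^sub>2 k"
  have list: "relative_transmissions C A\<^sub>1 A\<^sub>2 B\<^sub>1 B\<^sub>2 =
      map (arm e) [0..<Suc C] @ map (arm m) [1..<Suc A\<^sub>1] @ map (arm (m + 2)) [1..<Suc A\<^sub>2] @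
      map ?f [1..<Suc B\<^sub>1] @ map ?g [1..<Suc B\<^sub>2]"
  proof -
    have n: "int (C + 1 + A\<^sub>1 + A\<^sub>2 + B\<^sub>1 + B\<^sub>2) - 2 * int A\<^sub>1 - 1 = m"
      "int (C + 1 + A\<^sub>1 + A\<^sub>2 + B\<^sub>1 + B\<^sub>2) - 2 * int A\<^sub>2 - 1 = m + 2"
      "int (C + 1 + A\<^sub>1 + A\<^sub>2 + B\<^sub>1 + B\<^sub>2) - 2 * int B\<^sub>1 - 1 = b\<^sub>1"
      "int (C + 1 + A\<^sub>1 + A\<^sub>2 + B\<^sub>1 + B\<^sub>2) - 2 * int B\<^sub>2 - 1 = b\<^sub>2"
      "2 * int (A\<^sub>1 + A\<^sub>2) - int (C + 1 + A\<^sub>1 + A\<^sub>2 + B\<^sub>1 + B\<^sub>2) + 1 = e"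
      by (simp_all add: A m(1) e(1) b\<^sub>1(1) b\<^sub>2(1))
    show ?thesis
      unfolding relative_transmissions_def Let_def n by (simp add: comp_def del: upt_Suc)
  qed
  have inj: "inj (arm e)" "inj (arm m)" "inj (arm (m + 2))" "inj ?f" "inj ?g"
    using inj_arm[OF e(2)] inj_arm[OF m(2)] inj_arm[of "m + 2"] inj_arm[OF b\<^sub>1(2)] inj_arm[OF b\<^sub>2(2)] m(2)
    by (auto simp: inj_def)
  let ?E = "arm e ` {0..<Suc C}" and ?M = "arm m ` {1..<Suc A\<^sub>1}" and ?N = "arm (m + 2) ` {1..<Suc A\<^sub>2}"
    and ?F = "?f ` {1..<Suc B\<^sub>1}" and ?G = "?g ` {1..<Suc B\<^sub>2}"
  have "arm e k = 0 \<or> between_arms m (arm e k)" if "k \<le> C" for k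
    using spine[OF _ that] by (cases "k = 0") auto
  then have "\<forall>x \<in> ?E. x = 0 \<or> between_arms m x"
    by auto
  moreover have "\<forall>x \<in> ?F \<union> ?G. between_arms m x"
    using leg\<^sub>1 leg\<^sub>2 by (auto simp: Suc_le_eq less_Suc_eq_le)
  ultimately have "\<forall>x \<in> ?E \<union> ?F \<union> ?G. x = 0 \<or> between_arms m x"
    by blast
  moreover have "x \<noteq> 0 \<and> \<not> between_arms m x" if "x \<in> ?M \<union> ?N" for x
  proof -
    have "0 < x"
      using that arm_pos[OF m(2)] arm_pos[of "m + 2"] m(2) by auto
    then show ?thesis
      using that not_arm_if_between_arms[OF m(2)] by auto
  qed
  ultimately have EFG_MN: "(?E \<union> ?F \<union> ?G) \<inter> (?M \<union> ?N) = {}"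
    by blast
  \<comment> \<open>Both arms start with the value 0, so a positive position is needed.\<close>
  have "arm m i \<noteq> arm (m + 2) j" if "0 < i" for i j
  proof (cases "i \<le> j")
    case True
    then have "arm m i \<le> arm m j"
      using arm_less[OF m(2), of i j] by (cases "i = j") auto
    also have "\<dots> < arm (m + 2) j"
      using that True by (simp add: arm_def algebra_simps)
    finally show ?thesis
      by simp
  next
    case False
    have "arm (m + 2) j < arm m (Suc j)"
      using arms_interlace(2)[OF m(2)] .
    also have "\<dots> \<le> arm m i"
      using arm_less[OF m(2), of "Suc j" i] False by (cases "i = Suc j") auto
    finally show ?thesis
      by simp
  qed
  then have MN: "?M \<inter> ?N = {}"
    by (auto simp: Suc_le_eq)
  have "arm e i < ?f k \<and> arm e i < ?g k" if "i \<le> C" "0 < k" for i k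
  proof -
    have "arm e i \<le> arm e C"
      using arm_less[OF e(2), of i C] that(1) by (cases "i = C") auto
    then show ?thesis
      using arm_pos[OF b\<^sub>1(2) that(2)] arm_pos[OF b\<^sub>2(2) that(2)] by simp
  qed
  then have "x < y" if "x \<in> ?E" "y \<in> ?F \<union> ?G" for x y
    using that by (auto simp: Suc_le_eq less_Suc_eq_le)
  then have E_FG: "?E \<inter> (?F \<union> ?G) = {}"
    by blast
  have "?f j \<noteq> ?g k" if k: "0 < k" "k \<le> B\<^sub>2" for j k
  proof -
    obtain a where "arm b\<^sub>1 a < arm b\<^sub>2 k" "arm b\<^sub>2 k < arm b\<^sub>1 (Suc a)"
      using legs[OF k] by blast
    then show ?thesis
      using not_arm_if_between[OF b\<^sub>1(2), of a "arm b\<^sub>2 k" j] by simp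
  qed
  then have FG: "?F \<inter> ?G = {}"
    by (auto simp: Suc_le_eq less_Suc_eq_le)
  have distinct_map_upt: "distinct (map h [i..<j])" if "inj h" for h :: "nat \<Rightarrow> int" and i j
    using that by (simp add: distinct_map inj_def inj_on_def)
  have distinct_append5: "distinct (es @ ms @ ns @ fs @ gs)"
    if "distinct es" "distinct ms" "distinct ns" "distinct fs" "distinct gs"
      "(set es \<union> set fs \<union> set gs) \<inter> (set ms \<union> set ns) = {}" "set ms \<inter> set ns = {}"
      "set es \<inter> (set fs \<union> set gs) = {}" "set fs \<inter> set gs = {}" for es ms ns fs gs :: "int list"
    using that by auto
  show ?thesis
    unfolding list
    by (intro distinct_append5 distinct_map_upt inj; unfold set_map set_upt; fact EFG_MN MN E_FG FG)
qed

text \<open>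
  If the second pendent path at \<open>v\<close> is a single edge, then it contributes the single value
  \<open>arm e C + d\<close>, where \<open>d\<close> is the increase of the transmission from \<open>v\<close> to the leaf.
\<close>

corollary distinct_relative_transmissions_leaf:
  assumes "A\<^sub>1 = Suc A\<^sub>2"
    and "m = int (C + B)" "e = 2 * int A\<^sub>2 - int (C + B)" "0 \<le> e"
    and b: "b = int (C + 2 + 2 * A\<^sub>2) - int B" "0 \<le> b"
    and d: "d = int (C + 1 + 2 * A\<^sub>2 + B)"
    and "\<And>i. 0 < i \<Longrightarrow> i \<le> C \<Longrightarrow> between_arms m (arm e i)"
    and "\<And>k. 0 < k \<Longrightarrow> k \<le> B \<Longrightarrow> between_arms m (arm e C + arm b k)"
    and leaf: "between_arms m (arm e C + d)"
    and "\<exists>a. arm b a < d \<and> d < arm b (Suc a)"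
  shows "distinct (relative_transmissions C A\<^sub>1 A\<^sub>2 B 1)"
proof (rule distinct_relative_transmissions[where m = m and e = e and b\<^sub>1 = b and b\<^sub>2 = "d - 1"])
  have arm_1: "arm (d - 1) k = d" if "0 < k" "k \<le> 1" for k
  proof -
    have "k = 1"
      using that by simp
    then show ?thesis
      by (simp add: arm_def)
  qed
  show "between_arms m (arm e C + arm (d - 1) k)" if "0 < k" "k \<le> 1" for k
    using leaf arm_1[OF that] by simp
  show "\<exists>a. arm b a < arm (d - 1) k \<and> arm (d - 1) k < arm b (Suc a)" if "0 < k" "k \<le> 1" for k
    using assms(11) arm_1[OF that] by simp
qed (use assms in simp_all)

section \<open>The seven families\<close>

text \<open>
  The position \<open>a\<close> of the gap comes from completing the square: \<open>4 * arm m a = (2 * a + m)\<^sup>2 - m\<^sup>2\<close>, and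
  to leading order the other values are also of this form with the same \<open>m\<close>. So \<open>a\<close> is the
  position on the path plus a multiple of \<open>t\<close> plus a constant. The lower order terms can move a
  value from one gap to the next along the path or with growing \<open>t\<close>; then a case distinction
  selects the gap. For the leaf at \<open>v\<close> in family (vii), the value is linear in \<open>t\<close> like \<open>m\<close>, so
  \<open>a\<close> is bounded.
\<close>

lemma distinct_relative_transmissions_i:
  "distinct (relative_transmissions (1 + t) (6 + 2 * t) (5 + 2 * t) (2 + t) 1)"
proof (rule distinct_relative_transmissions_leaf[where m = "2 * int t + 3" and e = "2 * int t + 7"
      and b = "4 * int t + 11" and d = "6 * int t + 14"])
  show "between_arms (2 * int t + 3) (arm (2 * int t + 7) i)" if "0 < i" "i \<le> 1 + t" for i
    using that by (intro between_armsI_high[of _ "i"]) (simp_all add: arm_def algebra_simps)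
  show "between_arms (2 * int t + 3) (arm (2 * int t + 7) (1 + t) + arm (4 * int t + 11) k)"
    if "0 < k" "k \<le> 2 + t" for k
    using that by (intro between_armsI_low[of _ "k + t + 2"]) (simp_all add: arm_def algebra_simps)
  show "between_arms (2 * int t + 3) (arm (2 * int t + 7) (1 + t) + (6 * int t + 14))"
    by (intro between_armsI_low[of _ "t + 3"]) (simp_all add: arm_def algebra_simps)
  show "\<exists>a. arm (4 * int t + 11) a < 6 * int t + 14 \<and> 6 * int t + 14 < arm (4 * int t + 11) (Suc a)"
    by (intro exI[of _ 1]) (simp add: arm_def algebra_simps)
qed simp_all

lemma distinct_relative_transmissions_ii:
  "distinct (relative_transmissions (2 + t) (7 + 2 * t) (6 + 2 * t) (5 + t) 1)"
proof (rule distinct_relative_transmissions_leaf[where m = "2 * int t + 7" and e = "2 * int t + 5"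
      and b = "4 * int t + 11" and d = "6 * int t + 20"])
  show "between_arms (2 * int t + 7) (arm (2 * int t + 5) i)" if "0 < i" "i \<le> 2 + t" for i
    using that by (intro between_armsI_high[of _ "i - 1"]) (simp_all add: arm_def algebra_simps of_nat_diff)
  show "between_arms (2 * int t + 7) (arm (2 * int t + 5) (2 + t) + arm (4 * int t + 11) k)"
    if "0 < k" "k \<le> 5 + t" for k
    using that by (intro between_armsI_high[of _ "k + t + 1"]) (simp_all add: arm_def algebra_simps)
  show "between_arms (2 * int t + 7) (arm (2 * int t + 5) (2 + t) + (6 * int t + 20))"
    by (intro between_armsI_low[of _ "t + 3"]) (simp_all add: arm_def algebra_simps)
  show "\<exists>a. arm (4 * int t + 11) a < 6 * int t + 20 \<and> 6 * int t + 20 < arm (4 * int t + 11) (Suc a)"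
    by (intro exI[of _ 1]) (simp add: arm_def algebra_simps)
qed simp_all

lemma distinct_relative_transmissions_iii:
  "distinct (relative_transmissions (1 + 2 * t) (6 + 4 * t) (5 + 4 * t) (1 + 2 * t) 2)"
proof (rule distinct_relative_transmissions[where m = "4 * int t + 3" and e = "4 * int t + 7"
      and b\<^sub>1 = "8 * int t + 13" and b\<^sub>2 = "12 * int t + 11"])
  show "between_arms (4 * int t + 3) (arm (4 * int t + 7) i)" if "0 < i" "i \<le> 1 + 2 * t" for i
    using that by (intro between_armsI_high[of _ "i"]) (simp_all add: arm_def algebra_simps)
  show "between_arms (4 * int t + 3) (arm (4 * int t + 7) (1 + 2 * t) + arm (8 * int t + 13) k)"
    if "0 < k" "k \<le> 1 + 2 * t" for k
  proof (cases "k \<le> t + 1")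
    case True
    with that show ?thesis
      by (intro between_armsI_low[of _ "k + 2 * t + 2"]) (simp_all add: arm_def algebra_simps)
  next
    case False
    with that show ?thesis
      by (intro between_armsI_high[of _ "k + 2 * t + 2"]) (simp_all add: arm_def algebra_simps)
  qed
  show "between_arms (4 * int t + 3) (arm (4 * int t + 7) (1 + 2 * t) + arm (12 * int t + 11) k)"
    if "0 < k" "k \<le> 2" for k
  proof -
    have "k = 1 \<or> k = 2"
      using that by arith
    then consider "k = 1" | "k = 2" "t = 0" | "k = 2" "0 < t"
      by auto
    then show ?thesis
    proof cases
      case 1
      then show ?thesis
        by (intro between_armsI_low[of _ "2 * t + 3"]) (simp_all add: arm_def algebra_simps)
    next
      case 2
      then show ?thesis
        by (intro between_armsI_low[of _ 4]) (simp_all add: arm_def algebra_simps)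
    next
      case 3
      then show ?thesis
        by (intro between_armsI_high[of _ "2 * t + 4"]) (simp_all add: arm_def algebra_simps)
    qed
  qed
  show "\<exists>a. arm (8 * int t + 13) a < arm (12 * int t + 11) k \<and> arm (12 * int t + 11) k < arm (8 * int t + 13) (Suc a)"
    if "0 < k" "k \<le> 2" for k
  proof -
    have k: "k = 1 \<or> k = 2"
      using that by arith
    show ?thesis
    proof (cases "t = 0")
      case True
      with k show ?thesis
        by (intro exI[of _ "k - 1"]) (auto simp: arm_def algebra_simps)
    next
      case False
      with k show ?thesis
        by (intro exI[of _ k]) (auto simp: arm_def algebra_simps)
    qed
  qed
qed simp_all

lemma distinct_relative_transmissions_iv:
  "distinct (relative_transmissions (2 + 2 * t) (8 + 4 * t) (7 + 4 * t) (3 + 2 * t) 1)"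
proof (rule distinct_relative_transmissions_leaf[where m = "4 * int t + 5" and e = "4 * int t + 9"
      and b = "8 * int t + 15" and d = "12 * int t + 20"])
  show "between_arms (4 * int t + 5) (arm (4 * int t + 9) i)" if "0 < i" "i \<le> 2 + 2 * t" for i
    using that by (intro between_armsI_high[of _ "i"]) (simp_all add: arm_def algebra_simps)
  show "between_arms (4 * int t + 5) (arm (4 * int t + 9) (2 + 2 * t) + arm (8 * int t + 15) k)"
    if "0 < k" "k \<le> 3 + 2 * t" for k
    using that by (intro between_armsI_low[of _ "k + 2 * t + 3"]) (simp_all add: arm_def algebra_simps)
  show "between_arms (4 * int t + 5) (arm (4 * int t + 9) (2 + 2 * t) + (12 * int t + 20))"
    by (intro between_armsI_low[of _ "2 * t + 4"]) (simp_all add: arm_def algebra_simps)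
  show "\<exists>a. arm (8 * int t + 15) a < 12 * int t + 20 \<and> 12 * int t + 20 < arm (8 * int t + 15) (Suc a)"
    by (intro exI[of _ 1]) (simp add: arm_def algebra_simps)
qed simp_all

lemma distinct_relative_transmissions_v:
  "distinct (relative_transmissions (3 + 2 * t) (8 + 4 * t) (7 + 4 * t) (6 + 2 * t) 1)"
proof (rule distinct_relative_transmissions_leaf[where m = "4 * int t + 9" and e = "4 * int t + 5"
      and b = "8 * int t + 13" and d = "12 * int t + 24"])
  show "between_arms (4 * int t + 9) (arm (4 * int t + 5) i)" if "0 < i" "i \<le> 3 + 2 * t" for i
  proof (cases "i \<le> t + 2")
    case True
    with that show ?thesis
      by (intro between_armsI_high[of _ "i - 1"]) (simp_all add: arm_def algebra_simps of_nat_diff)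
  next
    case False
    with that show ?thesis
      by (intro between_armsI_low[of _ "i - 1"]) (simp_all add: arm_def algebra_simps of_nat_diff)
  qed
  show "between_arms (4 * int t + 9) (arm (4 * int t + 5) (3 + 2 * t) + arm (8 * int t + 13) k)"
    if "0 < k" "k \<le> 6 + 2 * t" for k
    using that by (intro between_armsI_low[of _ "k + 2 * t + 2"]) (simp_all add: arm_def algebra_simps)
  show "between_arms (4 * int t + 9) (arm (4 * int t + 5) (3 + 2 * t) + (12 * int t + 24))"
    by (intro between_armsI_high[of _ "2 * t + 3"]) (simp_all add: arm_def algebra_simps)
  show "\<exists>a. arm (8 * int t + 13) a < 12 * int t + 24 \<and> 12 * int t + 24 < arm (8 * int t + 13) (Suc a)"
    by (intro exI[of _ 1]) (simp add: arm_def algebra_simps)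
qed simp_all

lemma distinct_relative_transmissions_vi:
  "distinct (relative_transmissions (1 + t) (7 + 4 * t) (6 + 4 * t) (6 + 3 * t) 1)"
proof (rule distinct_relative_transmissions_leaf[where m = "4 * int t + 7" and e = "4 * int t + 5"
      and b = "6 * int t + 9" and d = "12 * int t + 20"])
  show "between_arms (4 * int t + 7) (arm (4 * int t + 5) i)" if "0 < i" "i \<le> 1 + t" for i
    using that by (intro between_armsI_high[of _ "i - 1"]) (simp_all add: arm_def algebra_simps of_nat_diff)
  show "between_arms (4 * int t + 7) (arm (4 * int t + 5) (1 + t) + arm (6 * int t + 9) k)"
    if "0 < k" "k \<le> 6 + 3 * t" for k
    using that by (intro between_armsI_high[of _ "k + t"]) (simp_all add: arm_def algebra_simps)
  show "between_arms (4 * int t + 7) (arm (4 * int t + 5) (1 + t) + (12 * int t + 20))"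
    by (intro between_armsI_high[of _ "t + 2"]) (simp_all add: arm_def algebra_simps)
  show "\<exists>a. arm (6 * int t + 9) a < 12 * int t + 20 \<and> 12 * int t + 20 < arm (6 * int t + 9) (Suc a)"
    by (intro exI[of _ 1]) (simp add: arm_def algebra_simps)
qed simp_all

lemma distinct_relative_transmissions_vii:
  "distinct (relative_transmissions 2 (7 + 4 * t) (6 + 4 * t) (5 + 4 * t) 1)"
proof (rule distinct_relative_transmissions_leaf[where m = "4 * int t + 7" and e = "4 * int t + 5"
      and b = "4 * int t + 11" and d = "12 * int t + 20"])
  show "between_arms (4 * int t + 7) (arm (4 * int t + 5) i)" if "0 < i" "i \<le> 2" for i
    using that by (intro between_armsI_high[of _ "i - 1"]) (simp_all add: arm_def algebra_simps of_nat_diff)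
  show "between_arms (4 * int t + 7) (arm (4 * int t + 5) 2 + arm (4 * int t + 11) k)"
    if "0 < k" "k \<le> 5 + 4 * t" for k
    using that by (intro between_armsI_high[of _ "k + 1"]) (simp_all add: arm_def algebra_simps)
  show "between_arms (4 * int t + 7) (arm (4 * int t + 5) 2 + (12 * int t + 20))"
  proof -
    consider "t = 0" | "t = 1 \<or> t = 2" | "t = 3 \<or> t = 4" | "5 \<le> t"
      by linarith
    then show ?thesis
    proof cases
      case 1
      then show ?thesis
        by (intro between_armsI_low[of _ 3]) (simp_all add: arm_def algebra_simps)
    next
      case 2
      then show ?thesis
        by (intro between_armsI_high[of _ 3]) (auto simp: arm_def algebra_simps)
    next
      case 3
      then show ?thesis
        by (intro between_armsI_low[of _ 4]) (auto simp: arm_def algebra_simps)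
    next
      case 4
      then show ?thesis
        by (intro between_armsI_high[of _ 4]) (simp_all add: arm_def algebra_simps)
    qed
  qed
  show "\<exists>a. arm (4 * int t + 11) a < 12 * int t + 20 \<and> 12 * int t + 20 < arm (4 * int t + 11) (Suc a)"
    by (intro exI[of _ "if t < 2 then 1 else 2"]) (auto simp: arm_def algebra_simps)
qed simp_all

theorem theorem9:
  fixes t :: nat and G :: "'a pair_pre_digraph"
  shows "(is_H_tree G (1 + t) (6 + 2 * t) (5 + 2 * t) (2 + t) 1 \<longrightarrow> transmission_irregular G) \<and>
         (is_H_tree G (2 + t) (7 + 2 * t) (6 + 2 * t) (5 + t) 1 \<longrightarrow> transmission_irregular G) \<and>
         (is_H_tree G (1 + 2 * t) (6 + 4 * t) (5 + 4 * t) (1 + 2 * t) 2 \<longrightarrow> transmission_irregular G) \<and>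
         (is_H_tree G (2 + 2 * t) (8 + 4 * t) (7 + 4 * t) (3 + 2 * t) 1 \<longrightarrow> transmission_irregular G) \<and>
         (is_H_tree G (3 + 2 * t) (8 + 4 * t) (7 + 4 * t) (6 + 2 * t) 1 \<longrightarrow> transmission_irregular G) \<and>
         (is_H_tree G (1 + t) (7 + 4 * t) (6 + 4 * t) (6 + 3 * t) 1 \<longrightarrow> transmission_irregular G) \<and>
         (is_H_tree G 2 (7 + 4 * t) (6 + 4 * t) (5 + 4 * t) 1 \<longrightarrow> transmission_irregular G)"
  by (intro conjI impI; erule transmission_irregular_if_distinct;
      rule distinct_relative_transmissions_i
        distinct_relative_transmissions_ii
        distinct_relative_transmissions_iii
        distinct_relative_transmissions_iv
        distinct_relative_transmissions_v
        distinct_relative_transmissions_vi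
        distinct_relative_transmissions_vii)

end
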